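(* Fix $t>0$ and let $\mathcal{T}$ be the symmetric telegraph process with speed $c>0$ and rate $\lambda>0$. As $\lambda\to\infty$ and $c\to\infty$ with $\lambda/c^2\to 1$, the conditional law of $\max_{0\le s\le t}\mathcal{T}(s)$ given $V(0)=c$ converges weakly to the law of $\max_{0\le s\le t}B(s)$, where $\{B(s)\}_{s\ge0}$ is a standard Brownian motion.
   Context: Let $c>0$, $\lambda>0$. Let $V(0)$ be a random variable with $P\{V(0)=c\}=P\{V(0)=-c\}=\tfrac12$ and let $\{N(t)\}_{t\ge0}$ be a homogeneous Poisson process with rate $\lambda$, independent of $V(0)$. The symmetric telegraph process is $\mathcal{T}(t)=\int_0^t V(0)(-1)^{N(s)}\,ds$, $t\ge 0$ (so $\mathcal{T}(0)=0$). *)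

theory Defs
  imports "HOL-Probability.Probability"
begin

definition (in prob_space) indep_increments ::
    "'b measure \<Rightarrow> (real \<Rightarrow> 'a \<Rightarrow> 'b::minus) \<Rightarrow> bool" where
  "indep_increments S X \<longleftrightarrow>
     (\<forall>(\<tau> :: nat \<Rightarrow> real) n. 0 \<le> \<tau> 0 \<longrightarrow> incseq \<tau> \<longrightarrow>
        indep_vars (\<lambda>_. S) (\<lambda>i \<omega>. X (\<tau> (Suc i)) \<omega> - X (\<tau> i) \<omega>) {..<n})"

text \<open>
  Only times \<open>t \<ge> 0\<close> matter below. Path properties are required for every sample point, so that
  path functionals such as running maxima are genuine random variables even if \<open>M\<close> is not
  complete. As the paths of a Poisson process are nondecreasing, the truncated subtraction on
  the naturals yields the actual increments.
\<close>

locale poisson_process = prob_space M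
  for M :: "'a measure" and rate :: real and N :: "real \<Rightarrow> 'a \<Rightarrow> nat" +
  assumes rate_pos: "0 < rate"
    and rv [measurable]: "\<And>t. 0 \<le> t \<Longrightarrow> N t \<in> measurable M (count_space UNIV)"
    and start: "\<And>\<omega>. \<omega> \<in> space M \<Longrightarrow> N 0 \<omega> = 0"
    and mono_paths: "\<And>\<omega>. \<omega> \<in> space M \<Longrightarrow> mono_on {0..} (\<lambda>t. N t \<omega>)"
    and right_cont_paths:
      "\<And>\<omega> t. \<omega> \<in> space M \<Longrightarrow> 0 \<le> t \<Longrightarrow> continuous (at_right t) (\<lambda>s. N s \<omega>)"
    and indep: "indep_increments (count_space UNIV) N"
    and increments: "\<And>s t. 0 \<le> s \<Longrightarrow> s < t \<Longrightarrow>
      distr M (count_space UNIV) (\<lambda>\<omega>. N t \<omega> - N s \<omega>)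
        = measure_pmf (poisson_pmf (rate * (t - s)))"

locale brownian_motion = prob_space M
  for M :: "'a measure" and B :: "real \<Rightarrow> 'a \<Rightarrow> real" +
  assumes rv [measurable]: "\<And>t. 0 \<le> t \<Longrightarrow> B t \<in> borel_measurable M"
    and start: "\<And>\<omega>. \<omega> \<in> space M \<Longrightarrow> B 0 \<omega> = 0"
    and cont_paths: "\<And>\<omega>. \<omega> \<in> space M \<Longrightarrow> continuous_on {0..} (\<lambda>t. B t \<omega>)"
    and indep: "indep_increments borel B"
    and increments: "\<And>s t. 0 \<le> s \<Longrightarrow> s < t \<Longrightarrow>
      distributed M lborel (\<lambda>\<omega>. B t \<omega> - B s \<omega>) (normal_density 0 (sqrt (t - s)))"

definition telegraph :: "('a \<Rightarrow> real) \<Rightarrow> (real \<Rightarrow> 'a \<Rightarrow> nat) \<Rightarrow> real \<Rightarrow> 'a \<Rightarrow> real" where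
  "telegraph V0 N t \<omega> = (LINT s:{0..t}|lborel. V0 \<omega> * (- 1) ^ N s \<omega>)"

text \<open>
  Independence of \<open>V0\<close> from the whole process \<open>N\<close> is independence of the generated sigma-algebras;
  \<open>indep_var\<close> does not apply because the value types differ.
\<close>

locale symmetric_telegraph = poisson_process M rate N
  for M :: "'a measure" and c rate :: real and V0 :: "'a \<Rightarrow> real" and N :: "real \<Rightarrow> 'a \<Rightarrow> nat" +
  assumes speed_pos: "0 < c"
    and V0_rv [measurable]: "V0 \<in> borel_measurable M"
    and V0_plus: "prob {\<omega> \<in> space M. V0 \<omega> = c} = 1 / 2"
    and V0_minus: "prob {\<omega> \<in> space M. V0 \<omega> = - c} = 1 / 2"
    and V0_indep: "indep_set
      (sets (vimage_algebra (space M) V0 borel))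
      (sets (vimage_algebra (space M) (\<lambda>\<omega>. \<lambda>t\<in>{0..}. N t \<omega>)
         (PiM {0..} (\<lambda>_. count_space UNIV))))"

text \<open>For the continuous paths considered here the supremum is attained.\<close>

definition running_max :: "(real \<Rightarrow> 'a \<Rightarrow> real) \<Rightarrow> real \<Rightarrow> 'a \<Rightarrow> real" where
  "running_max X t \<omega> = (SUP s\<in>{0..t}. X s \<omega>)"

definition law :: "'a measure \<Rightarrow> ('a \<Rightarrow> real) \<Rightarrow> real measure" where
  "law M X = distr M borel X"

definition cond_law :: "'a measure \<Rightarrow> ('a \<Rightarrow> bool) \<Rightarrow> ('a \<Rightarrow> real) \<Rightarrow> real measure" where
  "cond_law M A X = law (uniform_measure M {\<omega> \<in> space M. A \<omega>}) X"

end

theory Submission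
  imports Defs
begin

text \<open>
  Given \<open>V(0) = c\<close>, the telegraph process is \<open>c\<close> times the integral of \<open>(-1)^N\<close>, which Riemann sums
  approximate uniformly by a persistent \<open>\<plusminus>1\<close> random walk. When this walk first reaches a level it is moving
  upwards, and an upward moving walk is at or above its present position at a later time with
  probability at least \<open>1/2\<close>, and above it by \<open>d\<close> with probability at most \<open>1/2 + (1 - q)^d\<close>, where \<open>q\<close> is
  the flip probability. Hence
  \<open>P(T(t) > a + \<gamma>) / (1/2 + exp(-\<lambda>\<gamma>/(4c))) \<le> P(max T > a) \<le> 2 P(T(t) > a - \<gamma>)\<close>, while Brownian motion
  satisfies the exact reflection principle. As \<open>\<lambda>/c\<close> tends to infinity, only the convergence of \<open>T(t)\<close> to
  a centred normal variable of variance \<open>t\<close> is left. It follows from Levy's continuity theorem, since an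
  eigenfunction of the generator of (position, velocity) determines the characteristic function up
  to \<open>O(1/c)\<close>.
\<close>

section \<open>Expectations along Markov chains driven by i.i.d. noise\<close>

text \<open>The velocity persists, so the position alone is not Markov and its reflection principle
  is only approximate: after a first passage the forced upward direction is an advantage that lasts
  until the first reversal, over distances of order \<open>c / rate\<close>. The shift \<gamma> of
  the level pays for this, and the exponential term bounds the chance of covering a fixed part of
  \<gamma> without reversal. The shift is harmless in the limit because the normal law has no atoms.
  No stopping times occur: the probabilities of hitting a level and of ending above it satisfy
  recursions that agree as long as the level has not been reached, and they are compared by
  induction on the number of steps. The same scheme yields the Brownian reflection principle; there
  the obstacle is not a bias of direction but the overshoot of a Gaussian step, which a fourth
  moment controls. The eigenvalue is the smaller root of \<nu>^2 - 2 \<lambda> \<nu> + (\<xi> c)^2 =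
  0, and this root tends to \<xi>^2 / 2. The conditioning disappears by independence of V(0) and N.
  Levels at or below 0 are handled by monotonicity of distribution functions.\<close>

primrec chain :: "('s \<Rightarrow> 'y \<Rightarrow> 's) \<Rightarrow> (nat \<Rightarrow> 'y) \<Rightarrow> 's \<Rightarrow> nat \<Rightarrow> 's" where
  "chain \<Phi> y x 0 = x"
| "chain \<Phi> y x (Suc k) = \<Phi> (chain \<Phi> y x k) (y k)"

text \<open>The one-step Markov operator of the chain; its powers evaluate expectations after
  several steps. States and values are general because one scheme serves integer walks with Poisson
  noise, real walks with Gaussian noise, and both real and complex test functions.\<close>

definition transition ::
    "('s \<Rightarrow> 'y \<Rightarrow> 's) \<Rightarrow> 'y measure \<Rightarrow> ('s \<Rightarrow> 'b::{banach, second_countable_topology}) \<Rightarrow> 's \<Rightarrow> 'b" where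
  "transition \<Phi> \<mu> F s = (LINT y|\<mu>. F (\<Phi> s y))"

lemma measurable_chain_PiM:
  assumes "case_prod \<Phi> \<in> S \<Otimes>\<^sub>M N \<rightarrow>\<^sub>M S" "x \<in> space S" "k \<le> K"
  shows "(\<lambda>f. chain \<Phi> f x k) \<in> PiM {..<K} (\<lambda>_. N) \<rightarrow>\<^sub>M S"
  using assms(3)
proof (induction k)
  case 0
  then show ?case using assms(2) by simp
next
  case (Suc k)
  have "(\<lambda>f. (chain \<Phi> f x k, f k)) \<in> PiM {..<K} (\<lambda>_. N) \<rightarrow>\<^sub>M S \<Otimes>\<^sub>M N"
    using Suc by (intro measurable_Pair) auto
  from measurable_compose[OF this assms(1)] show ?case by simp
qed

text \<open>The state after \<open>K\<close> steps is a function of the first \<open>K\<close> noise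
  variables and thus independent of the next one, so Fubini integrates the last step out and leaves
  \<open>transition \<Phi> \<mu> F\<close> to be evaluated after \<open>K\<close> steps. Hence the
  induction runs over all \<open>F\<close>; the bound \<open>C\<close> is inherited by
  \<open>transition \<Phi> \<mu> F\<close> and provides integrability.\<close>

lemma (in prob_space) expectation_chain:
  fixes F :: "'s \<Rightarrow> 'b::{banach, second_countable_topology}"
  assumes indep: "indep_vars (\<lambda>_. N) Y {..<K}"
    and dist: "\<And>i. i < K \<Longrightarrow> distr M N (Y i) = \<mu>"
    and \<mu>: "prob_space \<mu>" "sets \<mu> = sets N"
    and \<Phi>: "case_prod \<Phi> \<in> S \<Otimes>\<^sub>M N \<rightarrow>\<^sub>M S" and x: "x \<in> space S"
    and F: "F \<in> borel_measurable S" "\<And>s. norm (F s) \<le> C"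
  shows "expectation (\<lambda>\<omega>. F (chain \<Phi> (\<lambda>i. Y i \<omega>) x K)) = (transition \<Phi> \<mu> ^^ K) F x"
  using indep dist F
proof (induction K arbitrary: F)
  case 0
  then show ?case by (simp add: prob_space)
next
  case (Suc K)
  interpret mu: prob_space \<mu> by fact
  have C: "0 \<le> C" using Suc.prems(4) norm_ge_zero order_trans by blast
  have \<Phi>\<mu>: "case_prod \<Phi> \<in> S \<Otimes>\<^sub>M \<mu> \<rightarrow>\<^sub>M S"
    using \<Phi> \<mu>(2) by (simp cong: measurable_cong_sets sets_pair_measure_cong)
  let ?X = "\<lambda>\<omega>. chain \<Phi> (\<lambda>i. Y i \<omega>) x K"
  have XK: "chain \<Phi> (restrict f {..<K}) x k = chain \<Phi> f x k" if "k \<le> K" for k f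
    using that by (induction k) auto
  let ?A = "PiM {..<K} (\<lambda>_. N)" and ?B = "PiM {K} (\<lambda>_. N)"
  \<comment> \<open>Past and last step become two independent random elements of product spaces,
    whose joint law is a product measure.\<close>
  let ?f = "\<lambda>\<omega>. restrict (\<lambda>i. Y i \<omega>) {..<K}" and ?g = "\<lambda>\<omega>. restrict (\<lambda>i. Y i \<omega>) {K}"
  have ind: "indep_var ?A ?f ?B ?g"
    by (rule indep_var_restrict[OF Suc.prems(1)]) auto
  then have [measurable]: "?f \<in> M \<rightarrow>\<^sub>M ?A" "?g \<in> M \<rightarrow>\<^sub>M ?B"
    by (blast dest: indep_var_rv1 indep_var_rv2)+
  have YK [measurable]: "Y K \<in> M \<rightarrow>\<^sub>M N"
    using Suc.prems(1) by (auto simp: indep_vars_def)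
  interpret X: prob_space "distr M ?A ?f" by (rule prob_space_distr) simp
  interpret Y: prob_space "distr M ?B ?g" by (rule prob_space_distr) simp
  interpret XY: pair_prob_space "distr M ?A ?f" "distr M ?B ?g" ..
  have joint: "distr M (?A \<Otimes>\<^sub>M ?B) (\<lambda>\<omega>. (?f \<omega>, ?g \<omega>)) = distr M ?A ?f \<Otimes>\<^sub>M distr M ?B ?g"
    using ind by (simp add: indep_var_distribution_eq)
  have m\<mu>: "(\<lambda>(s, y). F (\<Phi> s y)) \<in> borel_measurable (S \<Otimes>\<^sub>M \<mu>)"
    using measurable_compose[OF \<Phi>\<mu> Suc.prems(3)] by (simp add: case_prod_beta)
  note chain = measurable_chain_PiM[OF \<Phi> x order_refl, of K]
  have "(\<lambda>p. (chain \<Phi> (fst p) x K, snd p K)) \<in> ?A \<Otimes>\<^sub>M ?B \<rightarrow>\<^sub>M S \<Otimes>\<^sub>M N"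
    by (intro measurable_Pair measurable_compose[OF measurable_fst chain]
        measurable_compose[OF measurable_snd measurable_component_singleton]) simp
  from measurable_compose[OF measurable_compose[OF this \<Phi>] Suc.prems(3)]
  have m: "(\<lambda>(f, g). F (\<Phi> (chain \<Phi> f x K) (g K))) \<in> borel_measurable (?A \<Otimes>\<^sub>M ?B)"
    by (simp add: case_prod_beta)
  have m': "(\<lambda>(f, g). F (\<Phi> (chain \<Phi> f x K) (g K))) \<in> borel_measurable (distr M ?A ?f \<Otimes>\<^sub>M distr M ?B ?g)"
    using m by (simp cong: measurable_cong_sets sets_pair_measure_cong)
  have TF: "transition \<Phi> \<mu> F \<in> borel_measurable S"
    unfolding transition_def by (rule mu.borel_measurable_lebesgue_integral[OF m\<mu>])
  have TFb: "norm (transition \<Phi> \<mu> F s) \<le> C" for s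
  proof -
    have "norm (transition \<Phi> \<mu> F s) \<le> (LINT y|\<mu>. C)"
      unfolding transition_def
      by (rule order_trans[OF integral_norm_bound integral_mono']) (use Suc.prems(4) C in auto)
    then show ?thesis by (simp add: mu.prob_space)
  qed
  have inner: "(LINT g|distr M ?B ?g. F (\<Phi> s (g K))) = transition \<Phi> \<mu> F s" if s: "s \<in> space S" for s
  proof -
    have F\<Phi>: "(\<lambda>y. F (\<Phi> s y)) \<in> borel_measurable N"
      using measurable_compose[OF measurable_compose[OF measurable_Pair1'[OF s] \<Phi>] Suc.prems(3)] by simp
    have "(LINT g|distr M ?B ?g. F (\<Phi> s (g K))) = expectation (\<lambda>\<omega>. F (\<Phi> s (Y K \<omega>)))"
      using measurable_compose[OF measurable_component_singleton[of K "{K}" "\<lambda>_. N"] F\<Phi>]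
      by (subst integral_distr) auto
    also have "\<dots> = transition \<Phi> \<mu> F s"
      using Suc.prems(2)[of K, symmetric] F\<Phi> by (simp add: transition_def integral_distr)
    finally show ?thesis .
  qed
  have XK: "chain \<Phi> (restrict f {..<K}) x k = chain \<Phi> f x k" if "k \<le> K" for k f
    using that by (induction k) auto
  have "expectation (\<lambda>\<omega>. F (chain \<Phi> (\<lambda>i. Y i \<omega>) x (Suc K)))
      = (LINT p|distr M (?A \<Otimes>\<^sub>M ?B) (\<lambda>\<omega>. (?f \<omega>, ?g \<omega>)). (case p of (f, g) \<Rightarrow> F (\<Phi> (chain \<Phi> f x K) (g K))))"
    by (subst integral_distr[OF _ m]) (auto simp: XK)
  also have "\<dots> = (LINT f|distr M ?A ?f. LINT g|distr M ?B ?g. F (\<Phi> (chain \<Phi> f x K) (g K)))"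
    unfolding joint
    by (rule XY.integral_fst'[symmetric, of "\<lambda>(f, g). F (\<Phi> (chain \<Phi> f x K) (g K))", simplified])
       (rule XY.P.integrable_const_bound[where B = C], use m' Suc.prems(4) in \<open>auto simp: case_prod_beta\<close>)
  also have "\<dots> = (LINT f|distr M ?A ?f. transition \<Phi> \<mu> F (chain \<Phi> f x K))"
    using measurable_space[OF chain] by (intro Bochner_Integration.integral_cong refl inner) auto
  also have "\<dots> = expectation (\<lambda>\<omega>. transition \<Phi> \<mu> F (chain \<Phi> (\<lambda>i. Y i \<omega>) x K))"
    by (subst integral_distr[OF _ measurable_compose[OF chain TF]]) (auto simp: XK)
  also have "\<dots> = (transition \<Phi> \<mu> ^^ K) (transition \<Phi> \<mu> F) x"
    by (rule Suc.IH[OF indep_vars_subset[OF Suc.prems(1)] _ TF TFb]) (use Suc.prems(2) in auto)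
  finally show ?case by (simp add: funpow_swap1)
qed

section \<open>The persistent random walk\<close>

text \<open>The state consists of the distance still to go to a level, the current direction, and a
  flag for having reached the level; \<open>y\<close> is the number of jumps in one cell. The
  reversal precedes the move, which matches Riemann sums evaluated at right end points.\<close>

definition walk_step :: "int \<times> int \<times> bool \<Rightarrow> nat \<Rightarrow> int \<times> int \<times> bool" where
  "walk_step = (\<lambda>(x, z, h) y. (x - z * (- 1) ^ y, z * (- 1) ^ y, h \<or> x - z * (- 1) ^ y \<le> 0))"

definition flip_prob :: "real \<Rightarrow> real" where
  "flip_prob r = measure_pmf.prob (poisson_pmf r) {y. odd y}"

lemma transition_walk_step:
  fixes F :: "int \<times> int \<times> bool \<Rightarrow> 'b::{banach, second_countable_topology}"
  shows "transition walk_step (measure_pmf (poisson_pmf r)) F (x, z, h) =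
    (1 - flip_prob r) *\<^sub>R F (x - z, z, h \<or> x - z \<le> 0) + flip_prob r *\<^sub>R F (x + z, - z, h \<or> x + z \<le> 0)"
proof -
  let ?p = "measure_pmf (poisson_pmf r)"
  let ?A = "F (x - z, z, h \<or> x - z \<le> 0)" and ?B = "F (x + z, - z, h \<or> x + z \<le> 0)"
  have *: "F (walk_step (x, z, h) y)
      = indicator {y. odd y} y *\<^sub>R ?B + indicator (UNIV - {y. odd y}) y *\<^sub>R ?A" for y
  proof -
    have "x \<le> - z \<longleftrightarrow> x + z \<le> 0" by linarith
    then show ?thesis by (cases "even y") (simp_all add: walk_step_def)
  qed
  have "measure ?p (UNIV - {y. odd y}) = 1 - flip_prob r"
    using measure_pmf.prob_compl[of "{y. odd y}" "poisson_pmf r"] by (simp add: flip_prob_def)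
  then show ?thesis
    unfolding transition_def *
    by (subst Bochner_Integration.integral_add)
       (auto simp: flip_prob_def measure_pmf.emeasure_eq_measure intro!: integrable_scaleR_left)
qed

text \<open>The exact value is (1 - exp(-2r)) / 2, but agreement with \<open>r\<close> up to second
  order is enough: an odd count includes the case of exactly one jump and excludes the case of
  none.\<close>

lemma flip_prob_bounds:
  assumes "0 < r"
  shows "0 \<le> flip_prob r" "r - r\<^sup>2 \<le> flip_prob r" "flip_prob r \<le> r"
proof -
  show "0 \<le> flip_prob r" by (simp add: flip_prob_def)
  have exp: "1 - r \<le> exp (- r)" using exp_ge_add_one_self[of "- r"] by simp
  have "r * (1 - r) \<le> r * exp (- r)" using exp assms by (intro mult_left_mono) auto
  also have "r * exp (- r) = measure_pmf.prob (poisson_pmf r) {1}"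
    using assms by (simp add: measure_pmf_single)
  also have "\<dots> \<le> flip_prob r"
    unfolding flip_prob_def by (intro measure_pmf.finite_measure_mono) auto
  finally show "r - r\<^sup>2 \<le> flip_prob r" by (simp add: algebra_simps power2_eq_square)
  have "flip_prob r \<le> measure_pmf.prob (poisson_pmf r) (UNIV - {0})"
    unfolding flip_prob_def by (intro measure_pmf.finite_measure_mono) auto
  also have "\<dots> = 1 - measure_pmf.prob (poisson_pmf r) {0}"
    using measure_pmf.prob_compl[of "{0}" "poisson_pmf r"] by simp
  also have "\<dots> = 1 - exp (- r)"
    using assms by (simp add: measure_pmf_single)
  finally show "flip_prob r \<le> r" using exp by simp
qed

text \<open>For a \<open>\<plusminus>1\<close> walk of current direction \<open>z\<close> that reverses with probability \<open>q\<close> before each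
  step, the probabilities that its position after \<open>K\<close> steps, respectively its maximum over the first
  \<open>K\<close> steps, is at least \<open>x\<close>. Level \<open>x\<close> can only be entered with direction \<open>+1\<close>, and without
  overshoot, which is what makes a reflection argument possible for this non-Markovian walk.\<close>

fun walk_ge :: "real \<Rightarrow> nat \<Rightarrow> int \<Rightarrow> int \<Rightarrow> real" where
  "walk_ge q 0 x z = (if x \<le> 0 then 1 else 0)"
| "walk_ge q (Suc K) x z = (1 - q) * walk_ge q K (x - z) z + q * walk_ge q K (x + z) (- z)"

fun walk_hit :: "real \<Rightarrow> nat \<Rightarrow> int \<Rightarrow> int \<Rightarrow> real" where
  "walk_hit q 0 x z = (if x \<le> 0 then 1 else 0)"
| "walk_hit q (Suc K) x z =
    (if x \<le> 0 then 1 else (1 - q) * walk_hit q K (x - z) z + q * walk_hit q K (x + z) (- z))"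

lemma transition_walk_ge:
  "(transition walk_step (measure_pmf (poisson_pmf r)) ^^ K) (\<lambda>(x, z, h). if x \<le> 0 then 1 else 0) (x, z, h)
    = walk_ge (flip_prob r) K x z"
  by (induction K arbitrary: x z h) (simp_all add: transition_walk_step)

text \<open>The maximum includes step 0, so the starting flag must already account for the sign of
  \<open>x\<close>. A raised flag stays raised, whence the value 1 if \<open>h\<close>
  holds.\<close>

lemma transition_walk_hit:
  "(transition walk_step (measure_pmf (poisson_pmf r)) ^^ K) (\<lambda>(x, z, h). if h then 1 else 0) (x, z, h \<or> x \<le> 0)
    = (if h then 1 else walk_hit (flip_prob r) K x z)"
proof (induction K arbitrary: x z h)
  case (Suc K)
  have T: "(transition walk_step (measure_pmf (poisson_pmf r)) ^^ K) (\<lambda>(x, z, h). if h then 1 else 0) (x, z, True)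
      = (1::real)" for x z
    using Suc.IH[of x z True] by simp
  show ?case
    using Suc.IH[of "x - z" z False] Suc.IH[of "x + z" "- z" False] by (auto simp: transition_walk_step T)
qed simp

section \<open>Reflection inequalities for the persistent walk\<close>

lemma walk_ge_bounds:
  assumes "0 \<le> q" "q \<le> 1"
  shows "0 \<le> walk_ge q K x z" "walk_ge q K x z \<le> 1"
  using assms by (induction K arbitrary: x z) (auto intro!: convex_bound_le)

lemma walk_hit_bounds:
  assumes "0 \<le> q" "q \<le> 1"
  shows "0 \<le> walk_hit q K x z" "walk_hit q K x z \<le> 1"
  using assms by (induction K arbitrary: x z) (auto intro!: convex_bound_le)

lemma walk_ge_antimono:
  assumes "0 \<le> q" "q \<le> 1" "x \<le> y"
  shows "walk_ge q K y z \<le> walk_ge q K x z"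
  using assms(3)
proof (induction K arbitrary: x y z)
  case (Suc K)
  show ?case
    using assms(1,2) Suc.IH[of "x - z" "y - z" z] Suc.IH[of "x + z" "y + z" "- z"] Suc.prems
    by (auto intro!: add_mono mult_left_mono)
qed auto

text \<open>Negate the walk: on the integers, ending below \<open>x\<close> means that the negated
  walk, whose direction is \<open>- z\<close>, ends at or above \<open>1 - x\<close>.\<close>

lemma walk_ge_reflect: "walk_ge q K x z = 1 - walk_ge q K (1 - x) (- z)"
proof (induction K arbitrary: x z)
  case (Suc K)
  have "walk_ge q K (x - z) z = 1 - walk_ge q K (1 - x + z) (- z)"
    "walk_ge q K (x + z) (- z) = 1 - walk_ge q K (1 - x - z) z"
    using Suc.IH[of "x - z" z] Suc.IH[of "x + z" "- z"] by (simp_all add: algebra_simps)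
  note * = this
  show ?case unfolding walk_ge.simps * by (simp add: algebra_simps)
qed auto

lemma walk_ge_zero_ge_half:
  assumes "0 \<le> q" "q \<le> 1 / 2"
  shows "1 / 2 \<le> walk_ge q K 0 1"
proof (induction K)
  case (Suc K)
  have "walk_ge q K 0 1 \<le> walk_ge q K (- 1) 1"
    using assms by (intro walk_ge_antimono) auto
  then have "(1 - q) * walk_ge q K 0 1 \<le> (1 - q) * walk_ge q K (- 1) 1"
    using assms by (intro mult_left_mono) auto
  moreover have "q * walk_ge q K 1 (- 1) = q * (1 - walk_ge q K 0 1)"
    using walk_ge_reflect[of q K 1 "- 1"] by simp
  \<comment> \<open>With \<open>p = walk_ge q K 0 1\<close>, the first step gives at least
    \<open>(1 - q) * p + q * (1 - p)\<close>, which exceeds 1/2 by exactly this product.\<close>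
  moreover have "0 \<le> (1 - 2 * q) * (walk_ge q K 0 1 - 1 / 2)"
    using assms Suc by (intro mult_nonneg_nonneg) auto
  ultimately show ?case by (simp add: algebra_simps)
qed simp

text \<open>As long as the distance is positive, both sides obey the same recursion, so the
  inequality is inherited until the level is entered. Entry occurs only from \<open>x = 1\<close> in
  direction 1, and from there the walk ends at or above the level with probability at least
  1/2.\<close>

lemma walk_hit_le:
  assumes q: "0 \<le> q" "q \<le> 1 / 2" and "1 \<le> x" "z = 1 \<or> z = - 1"
  shows "walk_hit q K x z \<le> 2 * walk_ge q K x z"
  using assms(3,4)
proof (induction K arbitrary: x z)
  case (Suc K)
  have *: "walk_hit q K (x - z) z \<le> 2 * walk_ge q K (x - z) z" if z: "z = 1 \<or> z = - 1" for z
  proof (cases "1 \<le> x - z")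
    case False
    then have "x = 1" "z = 1" using z Suc.prems by auto
    moreover have "walk_hit q K 0 1 \<le> 1" using q by (intro walk_hit_bounds) auto
    ultimately show ?thesis using walk_ge_zero_ge_half[OF q, of K] by simp
  qed (use Suc.IH z in auto)
  have "(1 - q) * walk_hit q K (x - z) z \<le> (1 - q) * (2 * walk_ge q K (x - z) z)"
    "q * walk_hit q K (x + z) (- z) \<le> q * (2 * walk_ge q K (x + z) (- z))"
    using q *[of z] *[of "- z"] Suc.prems by (auto intro!: mult_left_mono)
  then show ?case using Suc.prems by simp
qed auto

text \<open>Only a run of \<open>d\<close> moves without reversal profits from the upward direction.
  A reversal before that leaves the walk below the level and moving down, and then symmetry bounds
  the probability by 1/2.\<close>

lemma walk_ge_le_half_plus:
  assumes q: "0 \<le> q" "q \<le> 1 / 2"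
  shows "walk_ge q K (int d) 1 \<le> 1 / 2 + (1 - q) ^ d"
proof (induction K arbitrary: d)
  case 0
  then show ?case using q by (auto intro!: add_nonneg_nonneg)
next
  case (Suc K)
  show ?case
  proof (cases d)
    case 0
    have "walk_ge q (Suc K) 0 1 \<le> 1" using q by (intro walk_ge_bounds) auto
    then show ?thesis using 0 by simp
  next
    case (Suc e)
    have "walk_ge q K (int d + 1) (- 1) \<le> walk_ge q K 1 (- 1)"
      using q by (intro walk_ge_antimono) auto
    also have "\<dots> \<le> 1 / 2"
      using walk_ge_zero_ge_half[OF q, of K] walk_ge_reflect[of q K 1 "- 1"] by simp
    finally have "q * walk_ge q K (int d + 1) (- 1) \<le> q * (1 / 2)"
      using q by (intro mult_left_mono)
    moreover have "(1 - q) * walk_ge q K (int e) 1 \<le> (1 - q) * (1 / 2 + (1 - q) ^ e)"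
      using q Suc.IH[of e] by (intro mult_left_mono) auto
    ultimately have "(1 - q) * walk_ge q K (int e) 1 + q * walk_ge q K (int d + 1) (- 1)
      \<le> (1 - q) * (1 / 2 + (1 - q) ^ e) + q * (1 / 2)" by (rule add_mono[rotated])
    also have "\<dots> = 1 / 2 + (1 - q) ^ d" using Suc by (simp add: field_simps)
    finally show ?thesis using Suc by simp
  qed
qed

text \<open>Ending at \<open>x + int d\<close> requires reaching \<open>x\<close>, which happens in
  direction 1 and without overshoot; from there a further gain of \<open>d\<close> has probability
  at most \<open>1 / 2 + (1 - q) ^ d\<close>. The induction follows the common recursion up to that
  entry.\<close>

lemma walk_ge_le_hit:
  assumes q: "0 \<le> q" "q \<le> 1 / 2" and "1 \<le> x" "z = 1 \<or> z = - 1"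
  shows "walk_ge q K (x + int d) z \<le> (1 / 2 + (1 - q) ^ d) * walk_hit q K x z"
  using assms(3,4)
proof (induction K arbitrary: x z)
  case (Suc K)
  let ?h = "1 / 2 + (1 - q) ^ d"
  have *: "walk_ge q K (x + int d - z) z \<le> ?h * walk_hit q K (x - z) z" if z: "z = 1 \<or> z = - 1" for z
  proof (cases "1 \<le> x - z")
    case True
    then show ?thesis using Suc.IH[of "x - z" z] z by (simp add: algebra_simps)
  next
    case False
    then have "x = 1" "z = 1" using z Suc.prems by auto
    moreover have "walk_hit q K 0 1 = 1" by (cases K) auto
    ultimately show ?thesis using walk_ge_le_half_plus[OF q, of K d] by simp
  qed
  have "(1 - q) * walk_ge q K (x + int d - z) z \<le> (1 - q) * (?h * walk_hit q K (x - z) z)"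
    "q * walk_ge q K (x + int d + z) (- z) \<le> q * (?h * walk_hit q K (x + z) (- z))"
    using q *[of z] *[of "- z"] Suc.prems by (auto intro!: mult_left_mono)
  then have "walk_ge q (Suc K) (x + int d) z
    \<le> (1 - q) * (?h * walk_hit q K (x - z) z) + q * (?h * walk_hit q K (x + z) (- z))"
    unfolding walk_ge.simps by (rule add_mono)
  also have "\<dots> = ?h * ((1 - q) * walk_hit q K (x - z) z + q * walk_hit q K (x + z) (- z))"
    by (simp only: distrib_left mult.left_commute)
  also have "\<dots> = ?h * walk_hit q (Suc K) x z" using Suc.prems by simp
  finally show ?case .
qed auto

text \<open>With \<open>\<nu>\<close> and \<open>\<kappa>\<close> as in the eigenvalue equations assumed below, \<open>e^(i\<xi>x) (1 + \<kappa> sgn v)\<close> is an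
  eigenfunction, with eigenvalue \<open>-\<nu>\<close>, of the generator of the pair (position, velocity) \<open>(x, v)\<close> of the
  telegraph process. The states of \<^const>\<open>walk_step\<close> carry the remaining distance to a level, hence
  the sign in the exponent; \<open>sgn\<close> only serves to make the function bounded on all states.\<close>

definition walk_wave :: "complex \<Rightarrow> real \<Rightarrow> int \<times> int \<times> bool \<Rightarrow> complex" where
  "walk_wave \<kappa> \<theta> = (\<lambda>(x, z, h). cis (- \<theta> * of_int x) * (1 + \<kappa> * of_int (sgn z)))"

section \<open>Expansion of the eigenfunction along the walk\<close>

lemma cis_approx: "norm (cis \<theta> - (1 + \<i> * of_real \<theta>)) \<le> \<theta>\<^sup>2 / 2"
  using iexp_approx1[of \<theta> 1] by (simp add: cis_conv_exp power2_eq_square numeral_eq_Suc)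

text \<open>To first order in \<open>\<eta>\<close>, the two eigenvalue equations cancel the terms
  free of the direction and those proportional to it. \<open>C\<close> collects the rest: the Taylor
  remainders of both exponentials, the gap between \<open>q\<close> and \<open>l * \<eta>\<close>,
  and the product of reversal probability and displacement, where
  \<open>q \<le> l * \<eta> + (l * \<eta>)^2\<close> produces the last two summands. The flags are
  arbitrary because the wave ignores them.\<close>

lemma norm_transition_walk_wave:
  fixes \<kappa> :: complex and \<nu> \<eta> \<xi> c l :: real
  assumes q: "0 \<le> q" "q \<le> 1" "\<bar>q - l * \<eta>\<bar> \<le> (l * \<eta>)\<^sup>2"
    and l: "0 \<le> l" "0 \<le> \<eta>"
    and eig: "of_real \<nu> = - (\<i> * of_real (\<xi> * c) * \<kappa>)"
      "of_real \<nu> * \<kappa> = 2 * of_real l * \<kappa> - \<i> * of_real (\<xi> * c)"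
    and z: "z = 1 \<or> z = - 1"
  defines "C \<equiv> \<xi>\<^sup>2 * c\<^sup>2 * (1 + norm \<kappa>) + 2 * l\<^sup>2 * norm \<kappa> + 2 * l * \<bar>\<xi> * c\<bar> + 2 * l\<^sup>2 * \<eta> * \<bar>\<xi> * c\<bar>"
  shows "norm ((1 - q) *\<^sub>R walk_wave \<kappa> (\<xi> * c * \<eta>) (x - z, z, h) + q *\<^sub>R walk_wave \<kappa> (\<xi> * c * \<eta>) (x + z, - z, h')
     - (1 - \<nu> * \<eta>) *\<^sub>R walk_wave \<kappa> (\<xi> * c * \<eta>) (x, z, h'')) \<le> C * \<eta>\<^sup>2"
proof -
  define \<theta> where "\<theta> = \<xi> * c * \<eta>"
  define s :: real where "s = of_int z"
  have s: "s = 1 \<or> s = - 1" and zs: "of_int (sgn z) = complex_of_real s" "of_int (sgn (- z)) = - complex_of_real s"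
    using z by (auto simp: s_def)
  define e where "e = cis (\<theta> * s) - (1 + \<i> * of_real (\<theta> * s))"
  define e' where "e' = cis (- (\<theta> * s)) - (1 + \<i> * of_real (- (\<theta> * s)))"
  have e: "norm e \<le> \<theta>\<^sup>2 / 2" "norm e' \<le> \<theta>\<^sup>2 / 2"
    unfolding e_def e'_def using cis_approx[of "\<theta> * s"] cis_approx[of "- (\<theta> * s)"] s by auto
  define rem where "rem = of_real (1 - q) * e * (1 + \<kappa> * of_real s) + of_real q * e' * (1 - \<kappa> * of_real s)
    + of_real (l * \<eta> - q) * (2 * \<kappa> * of_real s) - of_real (2 * q * \<theta>) * \<i> * of_real s"
  have w: "walk_wave \<kappa> \<theta> (x - z, z, h) = cis (- \<theta> * x) * (cis (\<theta> * s) * (1 + \<kappa> * of_real s))"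
    "walk_wave \<kappa> \<theta> (x + z, - z, h') = cis (- \<theta> * x) * (cis (- (\<theta> * s)) * (1 - \<kappa> * of_real s))"
    "walk_wave \<kappa> \<theta> (x, z, h'') = cis (- \<theta> * x) * (1 + \<kappa> * of_real s)"
    unfolding walk_wave_def prod.case zs by (simp_all add: s_def cis_mult algebra_simps)
  have ss: "of_real s * of_real s = (1::complex)" using s by auto
  have "(1 - q) *\<^sub>R walk_wave \<kappa> \<theta> (x - z, z, h) + q *\<^sub>R walk_wave \<kappa> \<theta> (x + z, - z, h')
     - (1 - \<nu> * \<eta>) *\<^sub>R walk_wave \<kappa> \<theta> (x, z, h'') = cis (- \<theta> * x) * rem"
  proof -
    have c: "cis (\<theta> * s) = 1 + \<i> * of_real (\<theta> * s) + e" "cis (- (\<theta> * s)) = 1 - \<i> * of_real (\<theta> * s) + e'"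
      by (simp_all add: e_def e'_def)
    have n1: "of_real \<nu> * of_real \<eta> = - (\<i> * of_real \<theta> * \<kappa>)"
      unfolding eig(1) \<theta>_def by (simp add: algebra_simps)
    have n2: "of_real \<nu> * of_real \<eta> * \<kappa> = 2 * of_real (l * \<eta>) * \<kappa> - \<i> * of_real \<theta>"
      using arg_cong[OF eig(2), of "\<lambda>u. u * of_real \<eta>"] unfolding \<theta>_def by (simp add: algebra_simps)
    \<comment> \<open>\<open>n1\<close> removes the first-order terms without \<open>s\<close>,
      \<open>n2\<close> those linear in \<open>s\<close>, and squares of \<open>s\<close> are 1;
      \<open>rem\<close> is exactly what remains.\<close>
    have bracket: "of_real (1 - q) * ((1 + \<i> * of_real (\<theta> * s) + e) * (1 + \<kappa> * of_real s))
      + of_real q * ((1 - \<i> * of_real (\<theta> * s) + e') * (1 - \<kappa> * of_real s))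
      - of_real (1 - \<nu> * \<eta>) * (1 + \<kappa> * of_real s) = rem"
      using n1 n2 ss unfolding rem_def of_real_mult of_real_diff of_real_1 of_real_numeral by algebra
    have factor: "a * (u * A) + b * (u * B) - d * (u * D) = u * (a * A + b * B - d * D)" for a A b B d D u :: complex
      by (simp add: algebra_simps)
    show ?thesis
      unfolding w c scaleR_conv_of_real
      by (rule trans[OF factor arg_cong[OF bracket, of "(*) (cis (- \<theta> * x))"]])
  qed
  moreover have "norm rem \<le> C * \<eta>\<^sup>2"
  proof -
    have k: "norm (1 + \<kappa> * of_real s) \<le> 1 + norm \<kappa>" "norm (1 - \<kappa> * of_real s) \<le> 1 + norm \<kappa>"
      using s norm_triangle_ineq[of 1 \<kappa>] norm_triangle_ineq4[of 1 \<kappa>] by auto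
    have qn: "norm (complex_of_real (1 - q)) = 1 - q" "norm (complex_of_real q) = q"
      using q by (simp_all del: of_real_diff)
    have "norm (of_real (1 - q) * e * (1 + \<kappa> * of_real s)) \<le> (1 - q) * (\<theta>\<^sup>2 / 2) * (1 + norm \<kappa>)"
      "norm (of_real q * e' * (1 - \<kappa> * of_real s)) \<le> q * (\<theta>\<^sup>2 / 2) * (1 + norm \<kappa>)"
      unfolding norm_mult qn using q e k by (intro mult_mono mult_nonneg_nonneg; simp)+
    moreover have "norm (of_real (l * \<eta> - q) * (2 * \<kappa> * of_real s)) \<le> (l * \<eta>)\<^sup>2 * (2 * norm \<kappa>)"
    proof -
      have "norm (complex_of_real (l * \<eta> - q)) \<le> (l * \<eta>)\<^sup>2"
        unfolding norm_of_real using q(3) by linarith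
      moreover have "norm (2 * \<kappa> * complex_of_real s) = 2 * norm \<kappa>" using s by (auto simp: norm_mult)
      ultimately show ?thesis unfolding norm_mult[of "of_real (l * \<eta> - q)"] by (intro mult_mono) auto
    qed
    moreover have "norm (of_real (2 * q * \<theta>) * \<i> * of_real s) \<le> 2 * (l * \<eta> + (l * \<eta>)\<^sup>2) * \<bar>\<theta>\<bar>"
    proof -
      have "norm (of_real (2 * q * \<theta>) * \<i> * of_real s) = 2 * q * \<bar>\<theta>\<bar>"
        using q s by (auto simp: norm_mult abs_mult)
      also have "\<dots> \<le> 2 * (l * \<eta> + (l * \<eta>)\<^sup>2) * \<bar>\<theta>\<bar>"
        using q(3) by (intro mult_right_mono) auto
      finally show ?thesis .
    qed
    ultimately have "norm rem \<le> (1 - q) * (\<theta>\<^sup>2 / 2) * (1 + norm \<kappa>) + q * (\<theta>\<^sup>2 / 2) * (1 + norm \<kappa>)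
      + (l * \<eta>)\<^sup>2 * (2 * norm \<kappa>) + 2 * (l * \<eta> + (l * \<eta>)\<^sup>2) * \<bar>\<theta>\<bar>"
      unfolding rem_def by (intro order_trans[OF norm_triangle_ineq4] order_trans[OF norm_triangle_ineq] add_mono)
    also have "\<dots> = \<theta>\<^sup>2 / 2 * (1 + norm \<kappa>)
      + (l * \<eta>)\<^sup>2 * (2 * norm \<kappa>) + 2 * (l * \<eta> + (l * \<eta>)\<^sup>2) * \<bar>\<theta>\<bar>"
      by (simp add: field_simps)
    also have "\<dots> \<le> \<theta>\<^sup>2 * (1 + norm \<kappa>)
      + (l * \<eta>)\<^sup>2 * (2 * norm \<kappa>) + 2 * (l * \<eta> + (l * \<eta>)\<^sup>2) * \<bar>\<theta>\<bar>"
      by (intro add_right_mono mult_right_mono) auto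
    also have "\<dots> = C * \<eta>\<^sup>2"
      using l by (simp add: C_def \<theta>_def abs_mult power_mult_distrib algebra_simps power2_eq_square)
    finally show ?thesis .
  qed
  ultimately show ?thesis by (simp add: norm_mult \<theta>_def[symmetric])
qed

text \<open>Averaging over a step does not enlarge errors, and \<open>1 - \<nu> * \<eta>\<close>
  lies in the unit interval, so one-step errors merely add up. With \<open>K * \<eta>\<close> fixed,
  the total is of order \<open>\<eta>\<close>.\<close>

lemma norm_funpow_transition_walk_wave:
  fixes \<kappa> :: complex and \<nu> \<eta> \<xi> c l :: real
  assumes l: "0 < l" "0 < \<eta>" "l * \<eta> \<le> 1" "0 \<le> \<nu>" "\<nu> * \<eta> \<le> 1"
    and eig: "of_real \<nu> = - (\<i> * of_real (\<xi> * c) * \<kappa>)"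
      "of_real \<nu> * \<kappa> = 2 * of_real l * \<kappa> - \<i> * of_real (\<xi> * c)"
    and z: "z = 1 \<or> z = - 1"
  defines "C \<equiv> \<xi>\<^sup>2 * c\<^sup>2 * (1 + norm \<kappa>) + 2 * l\<^sup>2 * norm \<kappa> + 2 * l * \<bar>\<xi> * c\<bar> + 2 * l\<^sup>2 * \<eta> * \<bar>\<xi> * c\<bar>"
  shows "norm ((transition walk_step (measure_pmf (poisson_pmf (l * \<eta>))) ^^ K) (walk_wave \<kappa> (\<xi> * c * \<eta>)) (x, z, h)
    - (1 - \<nu> * \<eta>) ^ K *\<^sub>R walk_wave \<kappa> (\<xi> * c * \<eta>) (x, z, h)) \<le> real K * (C * \<eta>\<^sup>2)"
  using z
proof (induction K arbitrary: x z h)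
  case (Suc K)
  let ?W = "walk_wave \<kappa> (\<xi> * c * \<eta>)" and ?r = "1 - \<nu> * \<eta>"
  let ?T = "transition walk_step (measure_pmf (poisson_pmf (l * \<eta>)))"
  define q where "q = flip_prob (l * \<eta>)"
  have q: "0 \<le> q" "q \<le> 1" "\<bar>q - l * \<eta>\<bar> \<le> (l * \<eta>)\<^sup>2"
    using flip_prob_bounds[of "l * \<eta>"] l by (auto simp: q_def)
  have C: "0 \<le> C" unfolding C_def using l by (intro add_nonneg_nonneg mult_nonneg_nonneg) auto
  define a where "a = (x - z, z, h \<or> x - z \<le> 0)"
  define b where "b = (x + z, - z, h \<or> x + z \<le> 0)"
  have ab: "norm ((?T ^^ K) ?W a - ?r ^ K *\<^sub>R ?W a) \<le> real K * (C * \<eta>\<^sup>2)"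
    "norm ((?T ^^ K) ?W b - ?r ^ K *\<^sub>R ?W b) \<le> real K * (C * \<eta>\<^sup>2)"
    unfolding a_def b_def using Suc.IH Suc.prems by auto
  have step: "norm ((1 - q) *\<^sub>R ?W a + q *\<^sub>R ?W b - ?r *\<^sub>R ?W (x, z, h)) \<le> C * \<eta>\<^sup>2"
    unfolding a_def b_def C_def
    by (rule norm_transition_walk_wave[OF q _ _ eig Suc.prems]) (use l in auto)
  have "(?T ^^ Suc K) ?W (x, z, h) = (1 - q) *\<^sub>R (?T ^^ K) ?W a + q *\<^sub>R (?T ^^ K) ?W b"
    by (simp add: transition_walk_step a_def b_def q_def)
  then have "(?T ^^ Suc K) ?W (x, z, h) - ?r ^ Suc K *\<^sub>R ?W (x, z, h)
    = (1 - q) *\<^sub>R ((?T ^^ K) ?W a - ?r ^ K *\<^sub>R ?W a) + q *\<^sub>R ((?T ^^ K) ?W b - ?r ^ K *\<^sub>R ?W b)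
      + ?r ^ K *\<^sub>R ((1 - q) *\<^sub>R ?W a + q *\<^sub>R ?W b - ?r *\<^sub>R ?W (x, z, h))"
    by (simp add: scaleR_conv_of_real algebra_simps)
  also have "norm \<dots> \<le> (1 - q) * (real K * (C * \<eta>\<^sup>2)) + q * (real K * (C * \<eta>\<^sup>2)) + 1 * (C * \<eta>\<^sup>2)"
  proof (intro order_trans[OF norm_triangle_ineq] add_mono)
    have "\<bar>?r ^ K\<bar> \<le> 1" using l by (simp add: power_le_one)
    then show "norm (?r ^ K *\<^sub>R ((1 - q) *\<^sub>R ?W a + q *\<^sub>R ?W b - ?r *\<^sub>R ?W (x, z, h))) \<le> 1 * (C * \<eta>\<^sup>2)"
      unfolding norm_scaleR using step by (intro mult_mono) auto
  qed (use q ab in \<open>auto intro!: mult_left_mono\<close>)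
  also have "\<dots> = real (Suc K) * (C * \<eta>\<^sup>2)" by (simp add: algebra_simps)
  finally show ?case .
qed simp

section \<open>Riemann sums of the telegraph path\<close>

text \<open>Domination by finitely many values also supplies the boundedness that the supremum
  needs. The comparison serves both telegraph and Brownian paths.\<close>

lemma abs_SUP_minus_Max_le:
  fixes X :: "'s \<Rightarrow> real" and y :: "'i \<Rightarrow> real"
  assumes "finite I" "I \<noteq> {}" "A \<noteq> {}"
    and upper: "\<And>s. s \<in> A \<Longrightarrow> \<exists>i\<in>I. X s \<le> y i + e"
    and lower: "\<And>i. i \<in> I \<Longrightarrow> \<exists>s\<in>A. y i \<le> X s + e"
  shows "\<bar>(SUP s\<in>A. X s) - Max (y ` I)\<bar> \<le> e"
proof -
  have le: "X s \<le> Max (y ` I) + e" if s: "s \<in> A" for s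
  proof -
    obtain i where "i \<in> I" "X s \<le> y i + e" using upper[OF s] by blast
    moreover have "y i \<le> Max (y ` I)" using assms(1) \<open>i \<in> I\<close> by simp
    ultimately show ?thesis by linarith
  qed
  then have bdd: "bdd_above (X ` A)" by (intro bdd_aboveI2)
  have "(SUP s\<in>A. X s) \<le> Max (y ` I) + e"
    using le assms(3) by (intro cSUP_least)
  moreover have "Max (y ` I) \<in> y ` I" using assms(1,2) by (intro Max_in) auto
  then obtain i where i: "i \<in> I" "Max (y ` I) = y i" by blast
  obtain s where "s \<in> A" "y i \<le> X s + e" using lower[OF i(1)] by blast
  moreover have "X s \<le> (SUP s\<in>A. X s)" using bdd \<open>s \<in> A\<close> by (rule cSUP_upper2) simp
  ultimately show ?thesis using i by linarith
qed

context
  fixes f :: "real \<Rightarrow> nat" and v :: real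
  assumes mono: "mono_on {0..} f"
begin

lemma set_integrable_sign_path:
  assumes "0 \<le> a"
  shows "set_integrable lborel {a..b} (\<lambda>u. v * (- 1) ^ f u)"
proof -
  have "mono_on {a..b} (\<lambda>u. real (f u))"
    using mono assms by (auto simp: mono_on_def)
  then have "(\<lambda>u. real (f u)) \<in> borel_measurable (restrict_space borel {a..b})"
    by (rule borel_measurable_mono_on_fnc)
  \<comment> \<open>Measurability of monotone functions was applied to the real-valued path; the
    floor converts back to a natural exponent.\<close>
  then have "(\<lambda>u. v * (- 1) ^ nat \<lfloor>real (f u)\<rfloor>) \<in> borel_measurable (restrict_space borel {a..b})"
    by measurable
  then have borel: "set_borel_measurable lborel {a..b} (\<lambda>u. v * (- 1) ^ f u)"
    by (simp add: borel_measurable_restrict_space_iff set_borel_measurable_def)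
  have const: "set_integrable lborel {a..b} (\<lambda>u. v)"
    unfolding set_integrable_def
    by (intro integrable_scaleR_left integrable_real_indicator) (auto simp: emeasure_lborel_Icc_eq)
  show ?thesis
    by (rule set_integrable_bound[OF const borel]) (auto simp: abs_mult power_abs)
qed

lemma sign_path_integral:
  assumes "0 \<le> a" "a \<le> b"
  shows "(LINT u:{0..b}|lborel. v * (- 1) ^ f u)
    = (LINT u:{0..a}|lborel. v * (- 1) ^ f u) + integral {a..b} (\<lambda>u. v * (- 1) ^ f u)"
proof -
  note HK = set_borel_integral_eq_integral[OF set_integrable_sign_path[OF order_refl]]
  show ?thesis
    unfolding HK(2)
    by (rule Henstock_Kurzweil_Integration.integral_combine[symmetric]) (use assms HK(1) in auto)
qed

lemma abs_integral_sign_path_le: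
  assumes "0 \<le> a" "a \<le> b"
  shows "\<bar>integral {a..b} (\<lambda>u. v * (- 1) ^ f u)\<bar> \<le> \<bar>v\<bar> * (b - a)"
proof -
  have "((\<lambda>u. v * (- 1) ^ f u) has_integral integral {a..b} (\<lambda>u. v * (- 1) ^ f u)) {a..b}"
    using set_borel_integral_eq_integral[OF set_integrable_sign_path[OF assms(1), of b]]
    by (intro integrable_integral) auto
  then have "norm (integral {a..b} (\<lambda>u. v * (- 1) ^ f u)) \<le> \<bar>v\<bar> * measure lborel {a..b}"
    by (intro has_integral_bound_real) (auto simp: abs_mult power_abs)
  then show ?thesis using assms by simp
qed

text \<open>A cell contributes an error only if the path jumps in it, so the total error of the Riemann
  sums is controlled by the number of jumps.\<close>

lemma abs_integral_sign_path_cell_le: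
  assumes "0 \<le> a" "a \<le> b"
  shows "\<bar>integral {a..b} (\<lambda>u. v * (- 1) ^ f u) - v * (b - a) * (- 1) ^ f b\<bar>
    \<le> 2 * \<bar>v\<bar> * (b - a) * (real (f b) - real (f a))"
proof (cases "f a = f b")
  case True
  have const: "f u = f b" if "u \<in> {a..b}" for u
    using mono_onD[OF mono, of a u] mono_onD[OF mono, of u b] that assms True by auto
  have "integral {a..b} (\<lambda>u. v * (- 1) ^ f u) = integral {a..b} (\<lambda>u. v * (- 1) ^ f b)"
    by (rule Henstock_Kurzweil_Integration.integral_cong) (simp only: const)
  then show ?thesis using assms True by simp
next
  case False
  have "f a \<le> f b" using mono_onD[OF mono, of a b] assms by auto
  then have 1: "1 \<le> real (f b) - real (f a)" using False by linarith
  have "\<bar>v * (b - a) * (- 1) ^ f b\<bar> = \<bar>v\<bar> * (b - a)"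
    using assms by (simp add: abs_mult power_abs)
  then have "\<bar>integral {a..b} (\<lambda>u. v * (- 1) ^ f u) - v * (b - a) * (- 1) ^ f b\<bar> \<le> 2 * \<bar>v\<bar> * (b - a) * 1"
    using abs_integral_sign_path_le[OF assms] by linarith
  also have "\<dots> \<le> 2 * \<bar>v\<bar> * (b - a) * (real (f b) - real (f a))"
    using 1 assms by (intro mult_left_mono) auto
  finally show ?thesis .
qed

text \<open>The cell errors are proportional to the increments of \<open>f\<close> and telescope to
  its value at the last grid point.\<close>

lemma abs_sign_path_minus_Riemann_sum_le:
  assumes "0 \<le> \<eta>"
  shows "\<bar>(LINT u:{0..real k * \<eta>}|lborel. v * (- 1) ^ f u) - v * \<eta> * (\<Sum>j=1..k. (- 1) ^ f (real j * \<eta>))\<bar>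
    \<le> 2 * \<bar>v\<bar> * \<eta> * real (f (real k * \<eta>))"
proof (induction k)
  case 0
  have "(LINT u:{0..real 0 * \<eta>}|lborel. v * (- 1) ^ f u) = 0"
    using set_borel_integral_eq_integral(2)[OF set_integrable_sign_path, of 0 0] by simp
  then show ?case unfolding \<open>_ = 0\<close> using assms by simp
next
  case (Suc k)
  let ?a = "real k * \<eta>" and ?b = "real (Suc k) * \<eta>"
  let ?I = "\<lambda>s. LINT u:{0..s}|lborel. v * (- 1) ^ f u"
  have ab: "0 \<le> ?a" "?a \<le> ?b" and d: "?b - ?a = \<eta>" using assms by (auto simp: algebra_simps)
  have "?I ?b - v * \<eta> * (\<Sum>j=1..Suc k. (- 1) ^ f (real j * \<eta>))
    = (?I ?a - v * \<eta> * (\<Sum>j=1..k. (- 1) ^ f (real j * \<eta>)))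
      + (integral {?a..?b} (\<lambda>u. v * (- 1) ^ f u) - v * \<eta> * (- 1) ^ f ?b)"
    unfolding sign_path_integral[OF ab] by (simp add: algebra_simps)
  also have "\<bar>\<dots>\<bar> \<le> 2 * \<bar>v\<bar> * \<eta> * real (f ?a) + 2 * \<bar>v\<bar> * \<eta> * (real (f ?b) - real (f ?a))"
    using Suc.IH abs_integral_sign_path_cell_le[OF ab] unfolding d
    by (intro order_trans[OF abs_triangle_ineq] add_mono)
  also have "\<dots> = 2 * \<bar>v\<bar> * \<eta> * real (f ?b)" by (simp add: algebra_simps)
  finally show ?case .
qed

text \<open>At grid points the Riemann sum bound applies, with the jump count enlarged to that at
  time \<open>t\<close>; between grid points the integral moves by at most
  \<open>\<bar>v\<bar> * \<eta>\<close>, which accounts for the \<open>+ 1\<close>.\<close>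

lemma abs_SUP_sign_path_minus_Max_le:
  assumes t: "0 < t" and K: "0 < K"
  defines "\<eta> \<equiv> t / real K"
  shows "\<bar>(SUP s\<in>{0..t}. LINT u:{0..s}|lborel. v * (- 1) ^ f u)
      - Max ((\<lambda>k. v * \<eta> * (\<Sum>j=1..k. (- 1) ^ f (real j * \<eta>))) ` {..K})\<bar>
    \<le> \<bar>v\<bar> * \<eta> * (2 * real (f t) + 1)"
proof (rule abs_SUP_minus_Max_le)
  let ?I = "\<lambda>s. LINT u:{0..s}|lborel. v * (- 1) ^ f u"
  let ?y = "\<lambda>k. v * \<eta> * (\<Sum>j=1..k. (- 1) ^ f (real j * \<eta>))"
  have \<eta>: "0 < \<eta>" "real K * \<eta> = t" using t K by (auto simp: \<eta>_def)
  have grid: "real k * \<eta> \<in> {0..t}" if "k \<le> K" for k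
    using that \<eta> mult_right_mono[of "real k" "real K" \<eta>] by auto
  have close: "\<bar>?I (real k * \<eta>) - ?y k\<bar> \<le> 2 * \<bar>v\<bar> * \<eta> * real (f t)" if "k \<le> K" for k
  proof -
    have "f (real k * \<eta>) \<le> f t" using mono_onD[OF mono, of "real k * \<eta>" t] grid[OF that] by auto
    then have "2 * \<bar>v\<bar> * \<eta> * real (f (real k * \<eta>)) \<le> 2 * \<bar>v\<bar> * \<eta> * real (f t)"
      using \<eta> by (intro mult_left_mono) auto
    then show ?thesis
      using abs_sign_path_minus_Riemann_sum_le[of \<eta> k] \<eta>(1) by linarith
  qed
  have e: "\<bar>v\<bar> * \<eta> * (2 * real (f t) + 1) = 2 * \<bar>v\<bar> * \<eta> * real (f t) + \<bar>v\<bar> * \<eta>"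
    by (simp add: algebra_simps)
  have pos: "0 \<le> \<bar>v\<bar> * \<eta>" using \<eta> by simp
  show "\<exists>k\<in>{..K}. ?I s \<le> ?y k + \<bar>v\<bar> * \<eta> * (2 * real (f t) + 1)" if s: "s \<in> {0..t}" for s
  proof -
    define k where "k = nat \<lfloor>s / \<eta>\<rfloor>"
    have k: "real k \<le> s / \<eta>" "s / \<eta> < real k + 1"
      using s \<eta> by (auto simp: k_def)
    then have ks: "real k * \<eta> \<le> s" "s - real k * \<eta> \<le> \<eta>"
      using \<eta> by (auto simp: field_simps)
    then have "real k * \<eta> \<le> real K * \<eta>" using s \<eta> by auto
    then have kK: "k \<le> K" using \<eta>(1) by (simp only: mult_le_cancel_right_pos of_nat_le_iff)
    have "?I s = ?I (real k * \<eta>) + integral {real k * \<eta>..s} (\<lambda>u. v * (- 1) ^ f u)"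
      using ks \<eta> by (intro sign_path_integral) auto
    moreover have "\<bar>integral {real k * \<eta>..s} (\<lambda>u. v * (- 1) ^ f u)\<bar> \<le> \<bar>v\<bar> * (s - real k * \<eta>)"
      using ks \<eta> by (intro abs_integral_sign_path_le) auto
    moreover have "\<bar>v\<bar> * (s - real k * \<eta>) \<le> \<bar>v\<bar> * \<eta>"
      using ks by (intro mult_left_mono) auto
    ultimately have "?I s \<le> ?y k + \<bar>v\<bar> * \<eta> * (2 * real (f t) + 1)"
      using close[OF kK] unfolding e by linarith
    then show ?thesis using kK by blast
  qed
  show "\<exists>s\<in>{0..t}. ?y k \<le> ?I s + \<bar>v\<bar> * \<eta> * (2 * real (f t) + 1)" if "k \<in> {..K}" for k
  proof
    show "?y k \<le> ?I (real k * \<eta>) + \<bar>v\<bar> * \<eta> * (2 * real (f t) + 1)"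
      using close[of k] that pos unfolding e by simp
  qed (use grid that in auto)
qed (use t in auto)

end

section \<open>The sampled telegraph path as a chain driven by Poisson increments\<close>

context poisson_process
begin

definition walk :: "real \<Rightarrow> nat \<Rightarrow> 'a \<Rightarrow> int" where
  "walk \<eta> k \<omega> = (\<Sum>j=1..k. (- 1) ^ N (real j * \<eta>) \<omega>)"

definition jumps :: "real \<Rightarrow> nat \<Rightarrow> 'a \<Rightarrow> nat" where
  "jumps \<eta> i \<omega> = N (real (Suc i) * \<eta>) \<omega> - N (real i * \<eta>) \<omega>"

lemma measurable_walk:
  assumes "0 \<le> \<eta>"
  shows "walk \<eta> k \<in> M \<rightarrow>\<^sub>M count_space UNIV"
proof (induction k)
  case (Suc k)
  have [measurable]: "N (real (Suc k) * \<eta>) \<in> M \<rightarrow>\<^sub>M count_space UNIV"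
    using assms by (intro rv) auto
  note Suc [measurable]
  have "(\<lambda>\<omega>. walk \<eta> k \<omega> + (- 1) ^ N (real (Suc k) * \<eta>) \<omega>) \<in> M \<rightarrow>\<^sub>M count_space UNIV"
    by measurable
  then show ?case by (simp add: walk_def[abs_def])
qed (simp add: walk_def[abs_def])

text \<open>The initial direction is 1 because \<open>N 0\<close> vanishes. Monotone paths make the
  truncated difference in \<open>jumps\<close> a true increment, so that signs multiply along the
  chain.\<close>

lemma chain_walk_step_jumps:
  assumes "0 \<le> \<eta>" "\<omega> \<in> space M"
  shows "chain walk_step (\<lambda>i. jumps \<eta> i \<omega>) (x, 1, x \<le> 0) k
    = (x - walk \<eta> k \<omega>, (- 1) ^ N (real k * \<eta>) \<omega>, \<exists>j\<le>k. x \<le> walk \<eta> j \<omega>)"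
proof (induction k)
  case 0
  then show ?case using start[OF assms(2)] by (simp add: walk_def)
next
  case (Suc k)
  have "N (real k * \<eta>) \<omega> \<le> N (real (Suc k) * \<eta>) \<omega>"
    using assms(1) by (intro mono_onD[OF mono_paths[OF assms(2)]]) (auto intro: mult_right_mono)
  then have "N (real k * \<eta>) \<omega> + jumps \<eta> k \<omega> = N (real (Suc k) * \<eta>) \<omega>"
    by (simp add: jumps_def)
  then have sign: "(- 1) ^ N (real k * \<eta>) \<omega> * (- 1) ^ jumps \<eta> k \<omega> = (- 1 :: int) ^ N (real (Suc k) * \<eta>) \<omega>"
    unfolding power_add[symmetric] by simp
  have w: "walk \<eta> (Suc k) \<omega> = walk \<eta> k \<omega> + (- 1) ^ N (real (Suc k) * \<eta>) \<omega>"
    by (simp add: walk_def)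
  have "walk_step (x - a, z, h) y = (x - (a + z * (- 1) ^ y), z * (- 1) ^ y, h \<or> x \<le> a + z * (- 1) ^ y)" for a z h y
    by (auto simp: walk_step_def)
  then show ?case
    unfolding chain.simps Suc.IH by (simp only: sign w le_Suc_eq ex_disj_distrib) (auto simp: le_Suc_eq w)
qed

lemma expectation_walk:
  fixes F :: "int \<times> int \<times> bool \<Rightarrow> 'b::{banach, second_countable_topology}"
  assumes \<eta>: "0 < \<eta>" and F: "\<And>s. norm (F s) \<le> C"
  shows "expectation (\<lambda>\<omega>. F (x - walk \<eta> K \<omega>, (- 1) ^ N (real K * \<eta>) \<omega>, \<exists>j\<le>K. x \<le> walk \<eta> j \<omega>))
    = (transition walk_step (measure_pmf (poisson_pmf (rate * \<eta>))) ^^ K) F (x, 1, x \<le> 0)"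
proof -
  have "expectation (\<lambda>\<omega>. F (chain walk_step (\<lambda>i. jumps \<eta> i \<omega>) (x, 1, x \<le> 0) K))
    = (transition walk_step (measure_pmf (poisson_pmf (rate * \<eta>))) ^^ K) F (x, 1, x \<le> 0)"
  proof (rule expectation_chain[where N = "count_space UNIV" and S = "count_space UNIV"])
    show "indep_vars (\<lambda>_. count_space UNIV) (jumps \<eta>) {..<K}"
      using indep \<eta> unfolding indep_increments_def jumps_def[abs_def]
      by (auto intro!: incseq_SucI mult_right_mono elim!: allE[of _ "\<lambda>i. real i * \<eta>"])
    show "distr M (count_space UNIV) (jumps \<eta> i) = measure_pmf (poisson_pmf (rate * \<eta>))" for i
      using increments[of "real i * \<eta>" "real (Suc i) * \<eta>"] \<eta> by (simp add: jumps_def[abs_def] algebra_simps)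
    show "case_prod walk_step \<in> count_space UNIV \<Otimes>\<^sub>M count_space UNIV \<rightarrow>\<^sub>M count_space UNIV"
      by (subst pair_measure_countable) auto
    show "norm (F s) \<le> C" for s by (rule F)
  qed (auto simp: measure_pmf.prob_space_axioms)
  then show ?thesis
    using chain_walk_step_jumps \<eta> by (subst (asm) Bochner_Integration.integral_cong[OF refl]) (auto simp: less_imp_le)
qed

lemma prob_walk_ge:
  assumes "0 < \<eta>"
  shows "prob {\<omega> \<in> space M. x \<le> walk \<eta> K \<omega>} = walk_ge (flip_prob (rate * \<eta>)) K x 1"
proof -
  note [measurable] = measurable_walk[OF less_imp_le[OF assms]]
  have "prob {\<omega> \<in> space M. x \<le> walk \<eta> K \<omega>} = expectation (indicator {\<omega> \<in> space M. x \<le> walk \<eta> K \<omega>})"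
    by simp
  also have "\<dots> = expectation (\<lambda>\<omega>. (\<lambda>(x, z, h). if x \<le> 0 then 1 else 0)
      (x - walk \<eta> K \<omega>, (- 1) ^ N (real K * \<eta>) \<omega> :: int, \<exists>j\<le>K. x \<le> walk \<eta> j \<omega>))"
    by (intro Bochner_Integration.integral_cong) (auto simp: indicator_def)
  also have "\<dots> = walk_ge (flip_prob (rate * \<eta>)) K x 1"
    by (subst expectation_walk[OF assms, where C = 1]) (auto simp: transition_walk_ge)
  finally show ?thesis .
qed

lemma prob_walk_hit:
  assumes "0 < \<eta>"
  shows "prob {\<omega> \<in> space M. \<exists>j\<le>K. x \<le> walk \<eta> j \<omega>} = walk_hit (flip_prob (rate * \<eta>)) K x 1"
proof -
  note [measurable] = measurable_walk[OF less_imp_le[OF assms]]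
  have "prob {\<omega> \<in> space M. \<exists>j\<le>K. x \<le> walk \<eta> j \<omega>} = expectation (indicator {\<omega> \<in> space M. \<exists>j\<le>K. x \<le> walk \<eta> j \<omega>})"
    by simp
  also have "\<dots> = expectation (\<lambda>\<omega>. (\<lambda>(x, z, h). if h then 1 else 0)
      (x - walk \<eta> K \<omega>, (- 1) ^ N (real K * \<eta>) \<omega> :: int, \<exists>j\<le>K. x \<le> walk \<eta> j \<omega>))"
    by (intro Bochner_Integration.integral_cong) (auto simp: indicator_def)
  also have "\<dots> = walk_hit (flip_prob (rate * \<eta>)) K x 1"
    using transition_walk_hit[where r = "rate * \<eta>" and K = K and x = x and z = 1 and h = False]
    by (subst expectation_walk[OF assms, where C = 1]) auto
  finally show ?thesis .
qed

end

section \<open>The telegraph process at a fixed speed\<close>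

text \<open>Dominated convergence of the indicators turns pointwise convergence into convergence in
  probability.\<close>

lemma (in prob_space) prob_gt_tendsto_zero:
  fixes E :: "nat \<Rightarrow> 'a \<Rightarrow> real"
  assumes [measurable]: "\<And>n. E n \<in> borel_measurable M"
    and lim: "\<And>\<omega>. \<omega> \<in> space M \<Longrightarrow> (\<lambda>n. E n \<omega>) \<longlonglongrightarrow> 0" and "0 < \<gamma>"
  shows "(\<lambda>n. prob {\<omega> \<in> space M. E n \<omega> > \<gamma>}) \<longlonglongrightarrow> 0"
proof -
  have "(\<lambda>n. expectation (indicator {\<omega> \<in> space M. E n \<omega> > \<gamma>} :: 'a \<Rightarrow> real)) \<longlonglongrightarrow> expectation (\<lambda>_. 0)"
  proof (rule integral_dominated_convergence[where w = "\<lambda>_. 1"])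
    show "AE \<omega> in M. (\<lambda>n. indicator {\<omega> \<in> space M. E n \<omega> > \<gamma>} \<omega> :: real) \<longlonglongrightarrow> 0"
    proof (rule AE_I2)
      fix \<omega> assume "\<omega> \<in> space M"
      from order_tendstoD(2)[OF lim[OF this] \<open>0 < \<gamma>\<close>]
      show "(\<lambda>n. indicator {\<omega> \<in> space M. E n \<omega> > \<gamma>} \<omega> :: real) \<longlonglongrightarrow> 0"
        by (intro tendsto_eventually) (auto elim!: eventually_mono)
    qed
  qed (auto simp: indicator_def)
  then show ?thesis by simp
qed

lemma mesh_tendsto_zero: "(\<lambda>n. a * (t / real (Suc n)) * b) \<longlonglongrightarrow> 0"
proof -
  have "(\<lambda>n. a * t * b * inverse (real (Suc n))) \<longlonglongrightarrow> a * t * b * 0"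
    by (intro tendsto_mult tendsto_const LIMSEQ_inverse_real_of_nat)
  then show ?thesis by (simp add: field_simps)
qed

text \<open>The running maximum is a pointwise limit of maxima of Riemann sums. \<open>M\<close> is
  an arbitrary measure so that the result also applies to the sigma-algebra generated by
  \<open>N\<close>, where it gives independence from the initial velocity.\<close>

lemma borel_measurable_running_max_telegraph:
  fixes V0 :: "'a \<Rightarrow> real"
  assumes t: "0 < t" and V0 [measurable]: "V0 \<in> borel_measurable M"
    and N: "\<And>s. 0 \<le> s \<Longrightarrow> N s \<in> M \<rightarrow>\<^sub>M count_space UNIV"
    and mono: "\<And>\<omega>. \<omega> \<in> space M \<Longrightarrow> mono_on {0..} (\<lambda>s. N s \<omega> :: nat)"
  shows "running_max (telegraph V0 N) t \<in> borel_measurable M"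
proof (rule borel_measurable_LIMSEQ_real)
  let ?\<eta> = "\<lambda>n. t / real (Suc n)"
  define R where "R n \<omega> = Max ((\<lambda>k. V0 \<omega> * ?\<eta> n * (\<Sum>j=1..k. (- 1) ^ N (real j * ?\<eta> n) \<omega>)) ` {..Suc n})" for n \<omega>
  have [measurable]: "N (real j * ?\<eta> n) \<in> M \<rightarrow>\<^sub>M count_space UNIV" for j n
    using t by (intro N) auto
  have sum: "(\<lambda>\<omega>. (\<Sum>j=1..k. (- 1) ^ N (real j * ?\<eta> n) \<omega>) :: real) \<in> borel_measurable M" for k n
    by measurable
  show "R n \<in> borel_measurable M" for n
    unfolding R_def
    by (intro borel_measurable_Max borel_measurable_times V0 borel_measurable_const sum) simp
  fix \<omega> assume \<omega>: "\<omega> \<in> space M"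
  show "(\<lambda>n. R n \<omega>) \<longlonglongrightarrow> running_max (telegraph V0 N) t \<omega>"
  proof (rule Lim_transform[OF tendsto_const Lim_null_comparison])
    show "(\<lambda>n. \<bar>V0 \<omega>\<bar> * ?\<eta> n * (2 * real (N t \<omega>) + 1)) \<longlonglongrightarrow> 0" by (rule mesh_tendsto_zero)
    show "\<forall>\<^sub>F n in sequentially. norm (R n \<omega> - running_max (telegraph V0 N) t \<omega>)
        \<le> \<bar>V0 \<omega>\<bar> * ?\<eta> n * (2 * real (N t \<omega>) + 1)"
      using abs_SUP_sign_path_minus_Max_le[OF mono[OF \<omega>] t, where K = "Suc _" and v = "V0 \<omega>"]
      by (intro always_eventually allI) (simp add: R_def running_max_def telegraph_def abs_minus_commute)
  qed
qed

context poisson_process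
begin

text \<open>For positive \<open>v\<close>, the common bound for the distance between path and
  sampled walk, at the end point and for the maximum, with \<open>n + 1\<close> cells. It depends on
  the number of jumps and is therefore controlled in probability.\<close>

definition mesh_error :: "real \<Rightarrow> real \<Rightarrow> nat \<Rightarrow> 'a \<Rightarrow> real" where
  "mesh_error v t n \<omega> = v * (t / real (Suc n)) * (2 * real (N t \<omega>) + 1)"

lemma mesh_error_tendsto_zero: "(\<lambda>n. mesh_error v t n \<omega>) \<longlonglongrightarrow> 0"
  unfolding mesh_error_def by (rule mesh_tendsto_zero)

lemma borel_measurable_mesh_error: "0 < t \<Longrightarrow> mesh_error v t n \<in> borel_measurable M"
  using rv[of t] unfolding mesh_error_def[abs_def] by measurable

lemma prob_mesh_error_tendsto_zero:
  assumes "0 < t" "0 < \<delta>"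
  shows "(\<lambda>n. prob {\<omega> \<in> space M. mesh_error v t n \<omega> > \<delta>}) \<longlonglongrightarrow> 0"
  by (intro prob_gt_tendsto_zero borel_measurable_mesh_error mesh_error_tendsto_zero assms)

context
  fixes t v :: real and T R :: "'a \<Rightarrow> real"
  assumes t: "0 < t" and v: "0 < v"
  defines "T \<equiv> telegraph (\<lambda>_. v) N t"
    and "R \<equiv> running_max (telegraph (\<lambda>_. v) N) t"
begin

lemma borel_measurable_telegraph_max: "R \<in> borel_measurable M"
  unfolding R_def by (rule borel_measurable_running_max_telegraph[OF t]) (auto intro: rv mono_paths)

lemma abs_telegraph_minus_walk_le:
  assumes "\<omega> \<in> space M"
  shows "\<bar>T \<omega> - v * (t / real (Suc n)) * real_of_int (walk (t / real (Suc n)) (Suc n) \<omega>)\<bar> \<le> mesh_error v t n \<omega>"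
proof -
  define \<eta> where "\<eta> = t / real (Suc n)"
  have \<eta>: "0 < \<eta>" "real (Suc n) * \<eta> = t" using t by (auto simp: \<eta>_def)
  have "\<bar>T \<omega> - v * \<eta> * real_of_int (walk \<eta> (Suc n) \<omega>)\<bar> \<le> 2 * v * \<eta> * real (N t \<omega>)"
    using abs_sign_path_minus_Riemann_sum_le[OF mono_paths[OF assms], where \<eta> = \<eta> and v = v and k = "Suc n"] \<eta> v
    by (simp add: T_def telegraph_def walk_def)
  also have "\<dots> \<le> v * \<eta> * (2 * real (N t \<omega>) + 1)"
    using v \<eta> by (simp add: algebra_simps)
  finally show ?thesis unfolding \<eta>_def mesh_error_def .
qed

lemma borel_measurable_telegraph_end: "T \<in> borel_measurable M"
proof (rule borel_measurable_LIMSEQ_real)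
  show "(\<lambda>\<omega>. v * (t / real (Suc n)) * real_of_int (walk (t / real (Suc n)) (Suc n) \<omega>)) \<in> borel_measurable M" for n
  proof -
    have [measurable]: "walk (t / real (Suc n)) (Suc n) \<in> M \<rightarrow>\<^sub>M count_space UNIV"
      using t by (intro measurable_walk) auto
    show ?thesis by measurable
  qed
  fix \<omega> assume \<omega>: "\<omega> \<in> space M"
  show "(\<lambda>n. v * (t / real (Suc n)) * real_of_int (walk (t / real (Suc n)) (Suc n) \<omega>)) \<longlonglongrightarrow> T \<omega>"
  proof (rule Lim_transform[OF tendsto_const Lim_null_comparison])
    show "(\<lambda>n. mesh_error v t n \<omega>) \<longlonglongrightarrow> 0" by (rule mesh_error_tendsto_zero)
    show "\<forall>\<^sub>F n in sequentially. norm (v * (t / real (Suc n)) * real_of_int (walk (t / real (Suc n)) (Suc n) \<omega>) - T \<omega>)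
        \<le> mesh_error v t n \<omega>"
      using abs_telegraph_minus_walk_le[OF \<omega>] by (intro always_eventually allI) (simp add: abs_minus_commute)
  qed
qed

text \<open>The ceiling picks the first lattice level at or above \<open>a\<close>, so events of the
  scaled walk are exactly integer events.\<close>

lemma walk_hit_iff:
  fixes \<eta> :: real
  assumes "0 < \<eta>"
  shows "(\<exists>k\<le>K. \<lceil>a / (v * \<eta>)\<rceil> \<le> walk \<eta> k \<omega>) \<longleftrightarrow> a \<le> Max ((\<lambda>k. v * \<eta> * real_of_int (walk \<eta> k \<omega>)) ` {..K})"
proof -
  have "\<lceil>a / (v * \<eta>)\<rceil> \<le> w \<longleftrightarrow> a \<le> v * \<eta> * real_of_int w" for w
    using v assms by (simp add: ceiling_le_iff pos_divide_le_eq mult.commute)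
  then show ?thesis by (subst Max_ge_iff) auto
qed

lemma walk_ge_iff:
  fixes \<eta> :: real
  assumes "0 < \<eta>"
  shows "\<lceil>a / (v * \<eta>)\<rceil> \<le> walk \<eta> k \<omega> \<longleftrightarrow> a \<le> v * \<eta> * real_of_int (walk \<eta> k \<omega>)"
  using v assms by (simp add: ceiling_le_iff pos_divide_le_eq mult.commute)

lemma abs_telegraph_max_minus_walk_le:
  assumes "\<omega> \<in> space M"
  shows "\<bar>R \<omega> - Max ((\<lambda>k. v * (t / real (Suc n)) * real_of_int (walk (t / real (Suc n)) k \<omega>)) ` {..Suc n})\<bar>
    \<le> mesh_error v t n \<omega>"
  using abs_SUP_sign_path_minus_Max_le[OF mono_paths[OF assms] t, where K = "Suc n" and v = v] v
  by (simp add: R_def running_max_def telegraph_def walk_def mesh_error_def)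

lemma prob_le_prob_plus_error:
  fixes X Y :: "'a \<Rightarrow> real"
  assumes XY: "\<And>\<omega>. \<omega> \<in> space M \<Longrightarrow> \<bar>X \<omega> - Y \<omega>\<bar> \<le> mesh_error v t n \<omega>" and "b \<le> a - \<delta>"
    and Y: "{\<omega> \<in> space M. b \<le> Y \<omega>} \<in> events"
  shows "prob {\<omega> \<in> space M. a \<le> X \<omega>} \<le> prob {\<omega> \<in> space M. b \<le> Y \<omega>} + prob {\<omega> \<in> space M. mesh_error v t n \<omega> > \<delta>}"
proof -
  note [measurable] = borel_measurable_mesh_error[OF t]
  have E: "{\<omega> \<in> space M. mesh_error v t n \<omega> > \<delta>} \<in> events" by measurable
  have "prob {\<omega> \<in> space M. a \<le> X \<omega>} \<le> prob ({\<omega> \<in> space M. b \<le> Y \<omega>} \<union> {\<omega> \<in> space M. mesh_error v t n \<omega> > \<delta>})"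
  proof (rule finite_measure_mono)
    show "{\<omega> \<in> space M. a \<le> X \<omega>} \<subseteq> {\<omega> \<in> space M. b \<le> Y \<omega>} \<union> {\<omega> \<in> space M. mesh_error v t n \<omega> > \<delta>}"
      using XY assms(2) by (fastforce simp: abs_le_iff)
  qed (use Y E in auto)
  also have "\<dots> \<le> prob {\<omega> \<in> space M. b \<le> Y \<omega>} + prob {\<omega> \<in> space M. mesh_error v t n \<omega> > \<delta>}"
    using Y E by (rule measure_Un_le)
  finally show ?thesis .
qed

text \<open>\<open>walk_hit_le\<close> carried over to the path: each passage between path and walk
  costs a small shift and the probability of a large mesh error, which vanishes under
  refinement.\<close>

lemma prob_telegraph_max_le:
  assumes "0 < \<gamma>" "\<gamma> < a"
  shows "prob {\<omega> \<in> space M. a < R \<omega>} \<le> 2 * prob {\<omega> \<in> space M. a - \<gamma> < T \<omega>}"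
proof -
  note [measurable] = borel_measurable_telegraph_max borel_measurable_telegraph_end
  \<comment> \<open>One third of \<open>\<gamma>\<close> is spent on passing from path to walk, one
    on the way back, and one on the strict inequality.\<close>
  define \<delta> where "\<delta> = \<gamma> / 3"
  have \<delta>: "0 < \<delta>" "3 * \<delta> = \<gamma>" using assms by (auto simp: \<delta>_def)
  let ?\<eta> = "\<lambda>n. t / real (Suc n)"
  let ?err = "\<lambda>n. prob {\<omega> \<in> space M. mesh_error v t n \<omega> > \<delta>}"
  have rate_mesh: "(\<lambda>n. rate * ?\<eta> n) \<longlonglongrightarrow> 0" using mesh_tendsto_zero[of rate t 1] by simp
  have "\<forall>\<^sub>F n in sequentially. rate * ?\<eta> n < 1 / 2"
    using order_tendstoD(2)[OF rate_mesh, of "1 / 2"] by simp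
  then have ev: "\<forall>\<^sub>F n in sequentially. prob {\<omega> \<in> space M. a < R \<omega>}
      \<le> 2 * prob {\<omega> \<in> space M. a - \<gamma> < T \<omega>} + 3 * ?err n"
  proof eventually_elim
    case (elim n)
    define \<eta> where "\<eta> = ?\<eta> n"
    define x where "x = \<lceil>(a - \<delta>) / (v * \<eta>)\<rceil>"
    define q where "q = flip_prob (rate * \<eta>)"
    have \<eta>: "0 < \<eta>" using t by (simp add: \<eta>_def)
    note [measurable] = measurable_walk[OF less_imp_le[OF \<eta>]]
    have "rate * \<eta> < 1 / 2" using elim by (simp add: \<eta>_def)
    then have q: "0 \<le> q" "q \<le> 1 / 2"
      using flip_prob_bounds[of "rate * \<eta>"] rate_pos \<eta> by (auto simp: q_def)
    note close = abs_telegraph_minus_walk_le[of _ n, folded \<eta>_def]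
      abs_telegraph_max_minus_walk_le[of _ n, folded \<eta>_def]
    have x: "1 \<le> x" using assms \<delta> v \<eta> by (simp add: x_def one_le_ceiling)
    have "prob {\<omega> \<in> space M. a < R \<omega>} \<le> prob {\<omega> \<in> space M. a \<le> R \<omega>}"
      by (intro finite_measure_mono) auto
    also have "\<dots> \<le> prob {\<omega> \<in> space M. a - \<delta> \<le> Max ((\<lambda>k. v * \<eta> * real_of_int (walk \<eta> k \<omega>)) ` {..Suc n})} + ?err n"
      by (rule prob_le_prob_plus_error) (use close(2) in \<open>auto simp flip: walk_hit_iff[OF \<eta>]\<close>)
    also have "prob {\<omega> \<in> space M. a - \<delta> \<le> Max ((\<lambda>k. v * \<eta> * real_of_int (walk \<eta> k \<omega>)) ` {..Suc n})}
        = walk_hit q (Suc n) x 1"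
      unfolding walk_hit_iff[OF \<eta>, symmetric] x_def[symmetric] q_def by (rule prob_walk_hit[OF \<eta>])
    also have "\<dots> \<le> 2 * walk_ge q (Suc n) x 1"
      by (rule walk_hit_le[OF q x]) simp
    also have "walk_ge q (Suc n) x 1 = prob {\<omega> \<in> space M. a - \<delta> \<le> v * \<eta> * real_of_int (walk \<eta> (Suc n) \<omega>)}"
      unfolding walk_ge_iff[OF \<eta>, symmetric] x_def[symmetric] q_def by (rule prob_walk_ge[OF \<eta>, symmetric])
    also have "\<dots> \<le> prob {\<omega> \<in> space M. a - 2 * \<delta> \<le> T \<omega>} + ?err n"
      by (rule prob_le_prob_plus_error) (use close(1) in \<open>auto simp: abs_minus_commute\<close>)
    also have "prob {\<omega> \<in> space M. a - 2 * \<delta> \<le> T \<omega>} \<le> prob {\<omega> \<in> space M. a - \<gamma> < T \<omega>}"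
      using \<delta> by (intro finite_measure_mono) auto
    finally show ?case by simp
  qed
  have "(\<lambda>n. 2 * prob {\<omega> \<in> space M. a - \<gamma> < T \<omega>} + 3 * ?err n)
      \<longlonglongrightarrow> 2 * prob {\<omega> \<in> space M. a - \<gamma> < T \<omega>} + 3 * 0"
    by (intro tendsto_intros prob_mesh_error_tendsto_zero t \<delta>)
  from tendsto_lowerbound[OF this ev] show ?thesis by simp
qed

lemma prob_telegraph_end_le:
  assumes "0 < \<gamma>" "0 < a"
  shows "prob {\<omega> \<in> space M. a + \<gamma> < T \<omega>} \<le> (1 / 2 + exp (- (rate * \<gamma> / (4 * v)))) * prob {\<omega> \<in> space M. a < R \<omega>}"
proof -
  note [measurable] = borel_measurable_telegraph_max borel_measurable_telegraph_end
  \<comment> \<open>One sixth of \<open>\<gamma>\<close> for each of the two passages between path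
    and walk, three for the gap \<open>d\<close> in \<open>walk_ge_le_hit\<close>, and one for the
    strict inequality.\<close>
  define \<delta> where "\<delta> = \<gamma> / 6"
  have \<delta>: "0 < \<delta>" "6 * \<delta> = \<gamma>" using assms by (auto simp: \<delta>_def)
  let ?\<eta> = "\<lambda>n. t / real (Suc n)"
  let ?err = "\<lambda>n. prob {\<omega> \<in> space M. mesh_error v t n \<omega> > \<delta>}"
  let ?h = "1 / 2 + exp (- (rate * \<gamma> / (4 * v)))"
  have mesh: "(\<lambda>n. u * ?\<eta> n) \<longlonglongrightarrow> 0" for u using mesh_tendsto_zero[of u t 1] by simp
  have "\<forall>\<^sub>F n in sequentially. rate * ?\<eta> n < 1 / 4" "\<forall>\<^sub>F n in sequentially. v * ?\<eta> n < \<delta>"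
    using order_tendstoD(2)[OF mesh, of "1 / 4"] order_tendstoD(2)[OF mesh \<delta>(1)] by simp_all
  then have ev: "\<forall>\<^sub>F n in sequentially. prob {\<omega> \<in> space M. a + \<gamma> < T \<omega>}
      \<le> ?h * (prob {\<omega> \<in> space M. a < R \<omega>} + ?err n) + ?err n"
  proof eventually_elim
    case (elim n)
    define \<eta> where "\<eta> = ?\<eta> n"
    define x where "x = \<lceil>(a + 2 * \<delta>) / (v * \<eta>)\<rceil>"
    \<comment> \<open>Rounding down keeps \<open>x + int d\<close> within the level belonging to
      \<open>a + 5 * \<delta>\<close>. It loses less than one step, so \<open>d\<close> steps still
      cover the distance \<open>2 * \<delta>\<close> once
      \<open>v * \<eta> < \<delta>\<close>.\<close>
    define d where "d = nat \<lfloor>3 * \<delta> / (v * \<eta>)\<rfloor>"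
    define q where "q = flip_prob (rate * \<eta>)"
    have \<eta>: "0 < \<eta>" using t by (simp add: \<eta>_def)
    have small: "rate * \<eta> < 1 / 4" "v * \<eta> < \<delta>" using elim by (auto simp: \<eta>_def)
    note [measurable] = measurable_walk[OF less_imp_le[OF \<eta>]]
    note close = abs_telegraph_minus_walk_le[of _ n, folded \<eta>_def]
      abs_telegraph_max_minus_walk_le[of _ n, folded \<eta>_def]
    have r\<eta>: "0 < rate * \<eta>" using rate_pos \<eta> by simp
    have q: "0 \<le> q" "q \<le> 1 / 2"
      using flip_prob_bounds[OF r\<eta>] small by (auto simp: q_def)
    have x: "1 \<le> x" using assms \<delta> v \<eta> by (simp add: x_def one_le_ceiling)
    have B: "0 \<le> 3 * \<delta> / (v * \<eta>)" using \<delta> v \<eta> by simp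
    have d: "real d \<le> 3 * \<delta> / (v * \<eta>)" "3 * \<delta> / (v * \<eta>) - 1 \<le> real d"
      using B unfolding d_def by linarith+
    have "x + int d \<le> \<lceil>(a + 5 * \<delta>) / (v * \<eta>)\<rceil>"
    proof -
      have "(a + 2 * \<delta>) / (v * \<eta>) + real d \<le> (a + 5 * \<delta>) / (v * \<eta>)"
        using d(1) v \<eta> by (simp add: field_simps)
      then have "\<lceil>(a + 2 * \<delta>) / (v * \<eta>) + real_of_int (int d)\<rceil> \<le> \<lceil>(a + 5 * \<delta>) / (v * \<eta>)\<rceil>"
        by (intro ceiling_mono) simp
      then show ?thesis unfolding ceiling_add_of_int x_def .
    qed
    then have far: "walk_ge q (Suc n) \<lceil>(a + 5 * \<delta>) / (v * \<eta>)\<rceil> 1 \<le> walk_ge q (Suc n) (x + int d) 1"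
      using q by (intro walk_ge_antimono) auto
    have "(1 - q) ^ d \<le> exp (- (rate * \<gamma> / (4 * v)))"
    proof -
      have "2 * \<delta> / (v * \<eta>) \<le> 3 * \<delta> / (v * \<eta>) - 1"
        using small v \<eta> by (simp add: field_simps)
      then have d2: "2 * \<delta> / (v * \<eta>) \<le> real d" using d(2) by simp
      have "(rate * \<eta>)\<^sup>2 \<le> rate * \<eta> * (1 / 4)"
        unfolding power2_eq_square using r\<eta> small by (intro mult_left_mono) auto
      then have q34: "3 / 4 * (rate * \<eta>) \<le> q"
        using flip_prob_bounds(2)[OF r\<eta>] by (simp add: q_def)
      \<comment> \<open>The factor 3/4 in the reversal probability and the distance
        \<open>2 * \<delta>\<close>, which is a third of \<open>\<gamma>\<close>, combine to the
        constant 1/4.\<close>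
      have "rate * \<gamma> / (4 * v) = (3 / 4 * (rate * \<eta>)) * (2 * \<delta> / (v * \<eta>))"
        using v \<eta> \<delta>(2)[symmetric] by (simp add: field_simps)
      also have "\<dots> \<le> q * real d"
        using q34 d2 q r\<eta> \<delta> v \<eta> by (intro mult_mono) auto
      finally have le: "rate * \<gamma> / (4 * v) \<le> q * real d" .
      have "(1 - q) ^ d \<le> exp (- q) ^ d"
        using q exp_ge_add_one_self[of "- q"] by (intro power_mono) auto
      also have "\<dots> = exp (- (q * real d))" by (simp add: exp_of_nat_mult[symmetric] mult.commute)
      finally show ?thesis using le by (smt (verit) exp_le_cancel_iff)
    qed
    then have h: "1 / 2 + (1 - q) ^ d \<le> ?h" by simp
    have "prob {\<omega> \<in> space M. a + \<gamma> < T \<omega>} \<le> prob {\<omega> \<in> space M. a + \<gamma> \<le> T \<omega>}"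
      by (intro finite_measure_mono) auto
    also have "\<dots> \<le> prob {\<omega> \<in> space M. a + 5 * \<delta> \<le> v * \<eta> * real_of_int (walk \<eta> (Suc n) \<omega>)} + ?err n"
      by (rule prob_le_prob_plus_error) (use close(1) \<delta> in auto)
    also have "prob {\<omega> \<in> space M. a + 5 * \<delta> \<le> v * \<eta> * real_of_int (walk \<eta> (Suc n) \<omega>)}
        = walk_ge q (Suc n) \<lceil>(a + 5 * \<delta>) / (v * \<eta>)\<rceil> 1"
      unfolding walk_ge_iff[OF \<eta>, symmetric] q_def by (rule prob_walk_ge[OF \<eta>])
    also have "\<dots> \<le> walk_ge q (Suc n) (x + int d) 1" by (rule far)
    also have "\<dots> \<le> (1 / 2 + (1 - q) ^ d) * walk_hit q (Suc n) x 1"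
      by (rule walk_ge_le_hit[OF q x]) simp
    also have "\<dots> \<le> ?h * walk_hit q (Suc n) x 1"
      using h q by (intro mult_right_mono walk_hit_bounds) auto
    also have "walk_hit q (Suc n) x 1
        = prob {\<omega> \<in> space M. a + 2 * \<delta> \<le> Max ((\<lambda>k. v * \<eta> * real_of_int (walk \<eta> k \<omega>)) ` {..Suc n})}"
      unfolding walk_hit_iff[OF \<eta>, symmetric] x_def[symmetric] q_def by (rule prob_walk_hit[OF \<eta>, symmetric])
    also have "?h * \<dots> \<le> ?h * (prob {\<omega> \<in> space M. a + \<delta> \<le> R \<omega>} + ?err n)"
      by (intro mult_left_mono prob_le_prob_plus_error)
         (use close(2) in \<open>auto simp: abs_minus_commute intro: add_nonneg_nonneg\<close>)
    also have "\<dots> \<le> ?h * (prob {\<omega> \<in> space M. a < R \<omega>} + ?err n)"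
      using \<delta> by (intro mult_left_mono add_right_mono finite_measure_mono) (auto intro: add_nonneg_nonneg)
    finally show ?case by simp
  qed
  have "(\<lambda>n. ?h * (prob {\<omega> \<in> space M. a < R \<omega>} + ?err n) + ?err n)
      \<longlonglongrightarrow> ?h * (prob {\<omega> \<in> space M. a < R \<omega>} + 0) + 0"
    by (intro tendsto_intros prob_mesh_error_tendsto_zero t \<delta>)
  from tendsto_lowerbound[OF this ev] show ?thesis by simp
qed

end

end

context poisson_process
begin

text \<open>The bound comes from evaluating the expectation of \<open>e^(i\<xi>T) (1 + \<kappa> (-1)^N(t))\<close> exactly.\<close>

lemma char_telegraph_end:
  fixes \<kappa> :: complex and \<nu> \<xi> t v :: real
  assumes t: "0 < t" and v: "0 < v" and \<nu>: "0 \<le> \<nu>"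
    and eig: "of_real \<nu> = - (\<i> * of_real (\<xi> * v) * \<kappa>)"
      "of_real \<nu> * \<kappa> = 2 * of_real rate * \<kappa> - \<i> * of_real (\<xi> * v)"
  shows "norm (char (law M (telegraph (\<lambda>_. v) N t)) \<xi> - of_real (exp (- (\<nu> * t))) * (1 + \<kappa>)) \<le> norm \<kappa>"
proof -
  define T where "T = telegraph (\<lambda>_. v) N t"
  have T [measurable]: "T \<in> borel_measurable M"
    unfolding T_def by (rule borel_measurable_telegraph_end[OF t v])
  have Nt [measurable]: "N t \<in> M \<rightarrow>\<^sub>M count_space UNIV" using t by (intro rv) auto
  \<comment> \<open>The exponential is an eigenfunction only together with this velocity factor;
    replacing the factor by 1 at the end costs \<open>norm \<kappa>\<close>.\<close>
  define z where "z \<omega> = 1 + \<kappa> * (- 1) ^ N t \<omega>" for \<omega>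
  have z [measurable]: "z \<in> borel_measurable M" unfolding z_def[abs_def] by measurable
  have nz: "norm (z \<omega>) \<le> 1 + norm \<kappa>" for \<omega>
    unfolding z_def by (rule order_trans[OF norm_triangle_ineq]) (simp add: norm_mult norm_power)
  define \<eta> where "\<eta> n = t / real (Suc n)" for n
  have \<eta>: "0 < \<eta> n" "real (Suc n) * \<eta> n = t" for n using t by (auto simp: \<eta>_def)
  define X where "X n \<omega> = v * \<eta> n * real_of_int (walk (\<eta> n) (Suc n) \<omega>)" for n \<omega>
  have X [measurable]: "X n \<in> borel_measurable M" for n
  proof -
    note [measurable] = measurable_walk[OF less_imp_le[OF \<eta>(1)], of n "Suc n"]
    show ?thesis unfolding X_def[abs_def] by measurable
  qed
  have XT: "(\<lambda>n. X n \<omega>) \<longlonglongrightarrow> T \<omega>" if "\<omega> \<in> space M" for \<omega>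
  proof (rule Lim_transform[OF tendsto_const Lim_null_comparison])
    show "(\<lambda>n. mesh_error v t n \<omega>) \<longlonglongrightarrow> 0" by (rule mesh_error_tendsto_zero)
    show "\<forall>\<^sub>F n in sequentially. norm (X n \<omega> - T \<omega>) \<le> mesh_error v t n \<omega>"
      using abs_telegraph_minus_walk_le[OF t v that]
      by (intro always_eventually allI) (simp add: abs_minus_commute X_def T_def \<eta>_def)
  qed
  have lim1: "(\<lambda>n. expectation (\<lambda>\<omega>. cis (\<xi> * X n \<omega>) * z \<omega>)) \<longlonglongrightarrow> expectation (\<lambda>\<omega>. cis (\<xi> * T \<omega>) * z \<omega>)"
  proof (rule integral_dominated_convergence[where w = "\<lambda>_. 1 + norm \<kappa>"])
    show "AE \<omega> in M. (\<lambda>n. cis (\<xi> * X n \<omega>) * z \<omega>) \<longlonglongrightarrow> cis (\<xi> * T \<omega>) * z \<omega>"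
      unfolding cis_conv_exp by (intro AE_I2 tendsto_intros XT)
    show "(\<lambda>\<omega>. cis (\<xi> * T \<omega>) * z \<omega>) \<in> borel_measurable M"
      "(\<lambda>\<omega>. cis (\<xi> * X n \<omega>) * z \<omega>) \<in> borel_measurable M" for n
      unfolding cis_conv_exp by measurable
  qed (auto simp: norm_mult nz)
  \<comment> \<open>\<open>t\<close> replaces the mesh in the last summand of the one-step constant,
    which makes \<open>C\<close> independent of \<open>n\<close>.\<close>
  define C where "C = \<xi>\<^sup>2 * v\<^sup>2 * (1 + norm \<kappa>) + 2 * rate\<^sup>2 * norm \<kappa> + 2 * rate * \<bar>\<xi> * v\<bar> + 2 * rate\<^sup>2 * t * \<bar>\<xi> * v\<bar>"
  have mesh: "(\<lambda>n. u * \<eta> n) \<longlonglongrightarrow> 0" for u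
    using mesh_tendsto_zero[of u t 1] by (simp add: \<eta>_def)
  have "\<forall>\<^sub>F n in sequentially. rate * \<eta> n < 1" "\<forall>\<^sub>F n in sequentially. \<nu> * \<eta> n < 1"
    using order_tendstoD(2)[OF mesh, of 1] by simp_all
  then have "\<forall>\<^sub>F n in sequentially. norm (expectation (\<lambda>\<omega>. cis (\<xi> * X n \<omega>) * z \<omega>)
      - (1 - \<nu> * \<eta> n) ^ Suc n *\<^sub>R (1 + \<kappa>)) \<le> C * t * \<eta> n"
  proof eventually_elim
    case (elim n)
    have "\<eta> n \<le> real (Suc n) * \<eta> n" using \<eta>(1)[of n] by (simp add: algebra_simps)
    then have "\<eta> n \<le> t" using \<eta>(2) by simp
    have sgn: "sgn ((- 1) ^ k) = (- 1 :: int) ^ k" for k :: nat by (cases "even k") auto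
    \<comment> \<open>Measured from level 0, the remaining distance is minus the position, which
      undoes the sign in \<open>walk_wave\<close>.\<close>
    have "expectation (\<lambda>\<omega>. cis (\<xi> * X n \<omega>) * z \<omega>) = expectation (\<lambda>\<omega>. walk_wave \<kappa> (\<xi> * v * \<eta> n)
        (0 - walk (\<eta> n) (Suc n) \<omega>, (- 1) ^ N (real (Suc n) * \<eta> n) \<omega>, \<exists>j\<le>Suc n. 0 \<le> walk (\<eta> n) j \<omega>))"
      unfolding \<eta>(2) by (simp add: walk_wave_def X_def z_def algebra_simps sgn del: of_nat_Suc)
    also have "\<dots> = (transition walk_step (measure_pmf (poisson_pmf (rate * \<eta> n))) ^^ Suc n)
        (walk_wave \<kappa> (\<xi> * v * \<eta> n)) (0, 1, 0 \<le> (0::int))"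
    proof (rule expectation_walk[OF \<eta>(1), where C = "1 + norm \<kappa>"])
      fix s :: "int \<times> int \<times> bool"
      obtain x y h where s: "s = (x, y, h)" by (cases s)
      have "norm (complex_of_int (sgn y)) \<le> 1" by (simp add: sgn_if)
      then have "norm \<kappa> * norm (complex_of_int (sgn y)) \<le> norm \<kappa>" by (intro mult_left_le) auto
      then show "norm (walk_wave \<kappa> (\<xi> * v * \<eta> n) s) \<le> 1 + norm \<kappa>"
        using norm_triangle_ineq[of 1 "\<kappa> * of_int (sgn y)"]
        by (simp add: s walk_wave_def norm_mult)
    qed
    finally have "norm (expectation (\<lambda>\<omega>. cis (\<xi> * X n \<omega>) * z \<omega>) - (1 - \<nu> * \<eta> n) ^ Suc n *\<^sub>R (1 + \<kappa>))
      \<le> real (Suc n) * ((\<xi>\<^sup>2 * v\<^sup>2 * (1 + norm \<kappa>) + 2 * rate\<^sup>2 * norm \<kappa> + 2 * rate * \<bar>\<xi> * v\<bar>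
          + 2 * rate\<^sup>2 * \<eta> n * \<bar>\<xi> * v\<bar>) * (\<eta> n)\<^sup>2)"
      using norm_funpow_transition_walk_wave[OF rate_pos \<eta>(1) _ \<nu> _ eig, of n 1 "Suc n" 0 True] elim
      by (simp add: walk_wave_def del: funpow.simps of_nat_Suc power_Suc)
    also have "\<dots> \<le> real (Suc n) * (C * (\<eta> n)\<^sup>2)"
      unfolding C_def using \<open>\<eta> n \<le> t\<close> rate_pos
      by (intro mult_left_mono mult_right_mono add_left_mono) auto
    also have "\<dots> = C * (real (Suc n) * \<eta> n) * \<eta> n" by (simp add: power2_eq_square)
    finally show ?case unfolding \<eta>(2) .
  qed
  from Lim_null_comparison[OF this mesh]
  have "(\<lambda>n. expectation (\<lambda>\<omega>. cis (\<xi> * X n \<omega>) * z \<omega>) - (1 - \<nu> * \<eta> n) ^ Suc n *\<^sub>R (1 + \<kappa>)) \<longlonglongrightarrow> 0" .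
  moreover have "(\<lambda>n. (1 - \<nu> * \<eta> n) ^ Suc n *\<^sub>R (1 + \<kappa>)) \<longlonglongrightarrow> exp (- (\<nu> * t)) *\<^sub>R (1 + \<kappa>)"
    using LIMSEQ_Suc[OF tendsto_exp_limit_sequentially[of "- (\<nu> * t)"]]
    by (intro tendsto_scaleR tendsto_const) (simp add: \<eta>_def del: of_nat_Suc power_Suc)
  ultimately have "(\<lambda>n. expectation (\<lambda>\<omega>. cis (\<xi> * X n \<omega>) * z \<omega>)) \<longlonglongrightarrow> exp (- (\<nu> * t)) *\<^sub>R (1 + \<kappa>)"
    by (rule Lim_transform[rotated])
  then have eq: "expectation (\<lambda>\<omega>. cis (\<xi> * T \<omega>) * z \<omega>) = exp (- (\<nu> * t)) *\<^sub>R (1 + \<kappa>)"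
    using lim1 by (rule LIMSEQ_unique[symmetric])
  have int: "integrable M (\<lambda>\<omega>. cis (\<xi> * T \<omega>))" "integrable M (\<lambda>\<omega>. cis (\<xi> * T \<omega>) * z \<omega>)"
    by (rule integrable_const_bound[where B = "1 + norm \<kappa>"]; simp add: norm_mult nz cis_conv_exp)+
  have "char (law M T) \<xi> = expectation (\<lambda>\<omega>. cis (\<xi> * T \<omega>))"
    unfolding char_def law_def by (subst integral_distr) (auto simp: cis_conv_exp)
  then have "char (law M T) \<xi> - exp (- (\<nu> * t)) *\<^sub>R (1 + \<kappa>) = expectation (\<lambda>\<omega>. cis (\<xi> * T \<omega>) * (1 - z \<omega>))"
    unfolding eq[symmetric] using int by (simp add: right_diff_distrib)
  also have "norm \<dots> \<le> expectation (\<lambda>_. norm \<kappa>)"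
    by (rule order_trans[OF integral_norm_bound integral_mono'])
       (auto simp: norm_mult z_def norm_power)
  finally show ?thesis by (simp add: T_def scaleR_conv_of_real prob_space)
qed

end

text \<open>On the conditioning event the process coincides with the one of constant initial
  velocity \<open>c\<close>. The maximum of the latter is a function of \<open>N\<close> alone,
  hence independent of \<open>V0\<close>, and the probability of the event cancels.\<close>

lemma (in symmetric_telegraph) cond_law_running_max:
  assumes t: "0 < t"
  shows "cond_law M (\<lambda>\<omega>. V0 \<omega> = c) (running_max (telegraph V0 N) t) = law M (running_max (telegraph (\<lambda>_. c) N) t)"
proof (rule measure_eqI)
  let ?R = "running_max (telegraph V0 N) t" and ?Rc = "running_max (telegraph (\<lambda>_. c) N) t"
  let ?A = "{\<omega> \<in> space M. V0 \<omega> = c}"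
  let ?FN = "vimage_algebra (space M) (\<lambda>\<omega>. \<lambda>t\<in>{0..}. N t \<omega>) (PiM {0..} (\<lambda>_. count_space UNIV))"
  have A [measurable]: "?A \<in> events" by measurable
  have R: "?R \<in> borel_measurable M"
    by (rule borel_measurable_running_max_telegraph[OF t]) (auto intro: rv mono_paths)
  have Rc: "?Rc \<in> borel_measurable M"
    by (rule borel_measurable_running_max_telegraph[OF t]) (auto intro: rv mono_paths)
  have NF: "N s \<in> ?FN \<rightarrow>\<^sub>M count_space UNIV" if s: "0 \<le> s" for s
  proof -
    have "(\<lambda>\<omega>. \<lambda>t\<in>{0..}. N t \<omega>) \<in> ?FN \<rightarrow>\<^sub>M PiM {0..} (\<lambda>_. count_space UNIV)"
      by (rule measurable_vimage_algebra1) (auto simp: space_PiM)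
    from measurable_compose[OF this measurable_component_singleton[of s]] s show ?thesis by simp
  qed
  have RcF: "?Rc \<in> borel_measurable ?FN"
    by (rule borel_measurable_running_max_telegraph[OF t]) (auto intro: NF mono_paths)
  show "sets (cond_law M (\<lambda>\<omega>. V0 \<omega> = c) ?R) = sets (law M ?Rc)"
    by (simp add: cond_law_def law_def)
  fix S assume "S \<in> sets (cond_law M (\<lambda>\<omega>. V0 \<omega> = c) ?R)"
  then have S [measurable]: "S \<in> sets borel" by (simp add: cond_law_def law_def)
  have "?A = V0 -` {c} \<inter> space M" by auto
  then have AV: "?A \<in> sets (vimage_algebra (space M) V0 borel)"
    by (simp add: in_vimage_algebra)
  have RS: "?Rc -` S \<inter> space M \<in> sets ?FN"
    using measurable_sets[OF RcF S] by simp
  have RM: "?R -` S \<inter> space M \<in> events" using R S by (rule measurable_sets)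
  have same: "?A \<inter> (?R -` S \<inter> space M) = ?A \<inter> (?Rc -` S \<inter> space M)"
    by (auto simp: running_max_def telegraph_def)
  have "emeasure (cond_law M (\<lambda>\<omega>. V0 \<omega> = c) ?R) S = emeasure (uniform_measure M ?A) (?R -` S \<inter> space M)"
    unfolding cond_law_def law_def using R S by (subst emeasure_distr) auto
  also have "\<dots> = emeasure M (?A \<inter> (?Rc -` S \<inter> space M)) / emeasure M ?A"
    using RM by (simp add: emeasure_uniform_measure same)
  also have "\<dots> = ennreal (prob ?A * prob (?Rc -` S \<inter> space M)) / ennreal (prob ?A)"
    using indep_setD[OF V0_indep AV RS] by (simp add: emeasure_eq_measure)
  also have "\<dots> = ennreal (prob (?Rc -` S \<inter> space M))"
    unfolding V0_plus by (subst divide_ennreal) auto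
  also have "\<dots> = emeasure (law M ?Rc) S"
    unfolding law_def using Rc S by (subst emeasure_distr) (auto simp: emeasure_eq_measure)
  finally show "emeasure (cond_law M (\<lambda>\<omega>. V0 \<omega> = c) ?R) S = emeasure (law M ?Rc) S" .
qed

section \<open>The maximum of Brownian motion\<close>

text \<open>Independent increments carry no direction, so remaining distance and flag suffice as a
  state.\<close>

definition max_step :: "real \<times> bool \<Rightarrow> real \<Rightarrow> real \<times> bool" where
  "max_step = (\<lambda>(x, h) y. (x - y, h \<or> x - y \<le> 0))"

text \<open>Symmetry of the step law is what drives the reflection inequalities; normality enters
  only through the probability of a large step.\<close>

locale symmetric_step = prob_space \<mu> for \<mu> :: "real measure" +
  assumes sets_step [simp, measurable_cong]: "sets \<mu> = sets borel"
    and symmetric_step: "distr \<mu> borel uminus = \<mu>"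
begin

primrec sum_ge :: "nat \<Rightarrow> real \<Rightarrow> real" where
  "sum_ge 0 x = (if x \<le> 0 then 1 else 0)"
| "sum_ge (Suc K) x = (LINT y|\<mu>. sum_ge K (x - y))"

primrec sum_hit :: "nat \<Rightarrow> real \<Rightarrow> real" where
  "sum_hit 0 x = (if x \<le> 0 then 1 else 0)"
| "sum_hit (Suc K) x = (if x \<le> 0 then 1 else LINT y|\<mu>. sum_hit K (x - y))"

lemma transition_sum_ge:
  "(transition max_step \<mu> ^^ K) (\<lambda>(x, h). if x \<le> 0 then 1 else 0) (x, h) = sum_ge K x"
  by (induction K arbitrary: x h) (simp_all add: transition_def max_step_def)

lemma transition_sum_hit:
  "(transition max_step \<mu> ^^ K) (\<lambda>(x, h). if h then 1 else 0) (x, h \<or> x \<le> 0) = (if h then 1 else sum_hit K x)"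
proof (induction K arbitrary: x h)
  case (Suc K)
  have "(transition max_step \<mu> ^^ K) (\<lambda>(x, h). if h then 1 else 0) (x, True) = (1::real)"
    "(transition max_step \<mu> ^^ K) (\<lambda>(x, h). if h then 1 else 0) (x, x \<le> 0) = sum_hit K x" for x
    using Suc.IH[of x True] Suc.IH[of x False] by simp_all
  note IH = this
  have step: "transition max_step \<mu> G (x, k) = (LINT y|\<mu>. G (x - y, k \<or> x - y \<le> 0))"
    for G :: "real \<times> bool \<Rightarrow> real" and x k
    by (simp add: transition_def max_step_def)
  show ?case
  proof (cases "h \<or> x \<le> 0")
    case True
    then have "(h \<or> x \<le> 0) = True" by simp
    then show ?thesis
      unfolding funpow.simps comp_def step by (simp only: simp_thms IH(1)) (use True in \<open>auto simp: prob_space\<close>)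
  next
    case False
    then have "(h \<or> x \<le> 0) = False" by simp
    then show ?thesis
      unfolding funpow.simps comp_def step by (simp only: simp_thms IH(2)) (use False in simp)
  qed
qed simp

lemma borel_measurable_sum_ge [measurable]: "sum_ge K \<in> borel_measurable borel"
proof (induction K)
  case (Suc K)
  note [measurable] = Suc
  show ?case by simp
qed simp

lemma borel_measurable_sum_hit [measurable]: "sum_hit K \<in> borel_measurable borel"
proof (induction K)
  case (Suc K)
  note [measurable] = Suc
  show ?case by simp
qed simp

lemma integrable_bounded:
  assumes "f \<in> borel_measurable borel" "\<And>x. 0 \<le> f x \<and> f x \<le> (1::real)"
  shows "integrable \<mu> f"
  using assms by (intro integrable_const_bound[where B = 1]) auto

lemma integral_bounded:
  assumes "f \<in> borel_measurable borel" "\<And>x. 0 \<le> f x \<and> f x \<le> (1::real)"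
  shows "0 \<le> (LINT y|\<mu>. f y) \<and> (LINT y|\<mu>. f y) \<le> 1"
  using integral_mono[OF integrable_bounded[OF assms], of "\<lambda>_. 1"] assms(2)
  by (auto simp: prob_space intro!: Bochner_Integration.integral_nonneg)

lemma sum_ge_bounds: "0 \<le> sum_ge K x \<and> sum_ge K x \<le> 1"
  by (induction K arbitrary: x) (auto intro!: integral_bounded[THEN conjunct1] integral_bounded[THEN conjunct2])

lemma sum_hit_bounds: "0 \<le> sum_hit K x \<and> sum_hit K x \<le> 1"
  by (induction K arbitrary: x) (auto intro!: integral_bounded[THEN conjunct1] integral_bounded[THEN conjunct2])

lemma integrable_sum_ge: "integrable \<mu> (\<lambda>y. sum_ge K (x - y))"
  using sum_ge_bounds by (intro integrable_bounded) auto

lemma integrable_sum_hit: "integrable \<mu> (\<lambda>y. sum_hit K (x - y))"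
  using sum_hit_bounds by (intro integrable_bounded) auto

text \<open>The sum \<open>x + y\<close> is preserved when the two walks are driven by opposite steps.\<close>

lemma sum_ge_add:
  "(x + y \<le> 0 \<longrightarrow> 1 \<le> sum_ge K x + sum_ge K y) \<and> (0 < x + y \<longrightarrow> sum_ge K x + sum_ge K y \<le> 1)"
proof (induction K arbitrary: x y)
  case (Suc K)
  have "sum_ge (Suc K) y = (LINT s|distr \<mu> borel uminus. sum_ge K (y - s))"
    by (simp add: symmetric_step)
  also have "\<dots> = (LINT s|\<mu>. sum_ge K (y + s))"
    by (subst integral_distr) auto
  finally have y: "sum_ge (Suc K) y = (LINT s|\<mu>. sum_ge K (y + s))" .
  have int: "integrable \<mu> (\<lambda>s. sum_ge K (y + s))"
    using sum_ge_bounds by (intro integrable_bounded) auto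
  have "sum_ge (Suc K) x + sum_ge (Suc K) y = (LINT s|\<mu>. sum_ge K (x - s) + sum_ge K (y + s))"
    unfolding y using integrable_sum_ge int by simp
  moreover have "1 \<le> sum_ge K (x - s) + sum_ge K (y + s)" if "x + y \<le> 0" for s
    using Suc.IH[of "x - s" "y + s"] that by simp
  then have "(LINT s|\<mu>. 1) \<le> (LINT s|\<mu>. sum_ge K (x - s) + sum_ge K (y + s))" if "x + y \<le> 0"
    using that integrable_sum_ge int by (intro integral_mono) auto
  moreover have "sum_ge K (x - s) + sum_ge K (y + s) \<le> 1" if "0 < x + y" for s
    using Suc.IH[of "x - s" "y + s"] that by simp
  then have "(LINT s|\<mu>. sum_ge K (x - s) + sum_ge K (y + s)) \<le> (LINT s|\<mu>. 1)" if "0 < x + y"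
    using that integrable_sum_ge int by (intro integral_mono) auto
  ultimately show ?case by (simp add: prob_space)
qed auto

text \<open>Overshoot is harmless in this direction: once the level is passed, the remaining
  distance is nonpositive, and \<open>sum_ge_add\<close> with equal arguments gives probability at
  least 1/2 of ending at or above the level.\<close>

lemma sum_hit_le: "sum_hit K x \<le> 2 * sum_ge K x"
proof (induction K arbitrary: x)
  case (Suc K)
  show ?case
  proof (cases "x \<le> 0")
    case True
    then show ?thesis using sum_ge_add[of x x "Suc K"] by simp
  next
    case False
    have "(LINT y|\<mu>. sum_hit K (x - y)) \<le> (LINT y|\<mu>. 2 * sum_ge K (x - y))"
      using Suc.IH integrable_sum_hit integrable_sum_ge by (intro integral_mono) auto
    then show ?thesis using False by simp
  qed
qed simp

text \<open>Here overshoot matters. If the entering step is at most \<open>\<delta>\<close>, a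
  positive distance to \<open>x + \<delta>\<close> remains and symmetry gives at most 1/2; larger
  steps are discarded by a union bound over all \<open>K\<close> steps.\<close>

lemma sum_ge_le_hit:
  assumes "0 < x" "0 \<le> \<delta>"
  shows "sum_ge K (x + \<delta>) \<le> 1 / 2 * sum_hit K x + real K * measure \<mu> {\<delta><..}"
  using assms(1)
proof (induction K arbitrary: x)
  case 0
  then show ?case using assms(2) by simp
next
  case (Suc K)
  let ?\<rho> = "measure \<mu> {\<delta><..}"
  have le: "sum_ge K (x + \<delta> - y) \<le> 1 / 2 * sum_hit K (x - y) + (real K * ?\<rho> + indicator {\<delta><..} y)" for y
  proof (cases "0 < x - y")
    case True
    then show ?thesis using Suc.IH[of "x - y"] by (simp add: algebra_simps indicator_def)
  next
    case False
    then have hit: "sum_hit K (x - y) = 1" by (cases K) auto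
    show ?thesis
    proof (cases "\<delta> < y")
      case True
      then show ?thesis using hit sum_ge_bounds[of K "x + \<delta> - y"] by (simp add: add_nonneg_nonneg add.commute add_increasing)
    next
      case False
      then have "sum_ge K (x + \<delta> - y) \<le> 1 / 2"
        using sum_ge_add[of "x + \<delta> - y" "x + \<delta> - y" K] Suc.prems by simp
      moreover have "0 \<le> real K * ?\<rho>" "indicator {\<delta><..} y = (0::real)" using False by auto
      ultimately show ?thesis using hit by linarith
    qed
  qed
  have ind: "integrable \<mu> (indicator {\<delta><..} :: real \<Rightarrow> real)"
    by (intro integrable_bounded) (auto simp: indicator_def)
  have "sum_ge (Suc K) (x + \<delta>) \<le> (LINT y|\<mu>. 1 / 2 * sum_hit K (x - y) + (real K * ?\<rho> + indicator {\<delta><..} y))"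
    unfolding sum_ge.simps using integrable_sum_ge integrable_sum_hit ind le
    by (intro integral_mono Bochner_Integration.integrable_add integrable_mult_right) auto
  also have "\<dots> = 1 / 2 * (LINT y|\<mu>. sum_hit K (x - y)) + (real K * ?\<rho> + ?\<rho>)"
    using integrable_sum_hit ind sets_eq_imp_space_eq[OF sets_step] prob_space
    by (subst Bochner_Integration.integral_add) auto
  finally show ?case using Suc.prems by (simp add: algebra_simps)
qed

end

section \<open>Gaussian steps\<close>

lemma symmetric_step_normal:
  assumes "0 < \<sigma>"
  shows "symmetric_step (density lborel (normal_density 0 \<sigma>))"
proof -
  let ?\<mu> = "density lborel (normal_density 0 \<sigma>)"
  interpret prob_space ?\<mu> using assms by (rule prob_space_normal_density)
  have id: "distributed ?\<mu> lborel (\<lambda>x. x) (normal_density 0 \<sigma>)"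
    by (auto simp: distributed_def intro!: distr_id2)
  have "distr ?\<mu> lborel uminus = ?\<mu>"
    using normal_density_affine[OF id assms, of "- 1" 0] by (simp add: distributed_def)
  then have "distr ?\<mu> borel uminus = ?\<mu>" by (simp cong: distr_cong)
  then show ?thesis by unfold_locales simp_all
qed

text \<open>Markov's inequality for the fourth moment. For \<open>K\<close> steps of variance
  \<open>\<eta>\<close> with \<open>K * \<eta> = t\<close>, the union bound is of order
  \<open>K * \<eta>^2\<close> and vanishes with the mesh, whereas second moments would leave a
  constant multiple of \<open>t\<close>.\<close>

lemma normal_tail_le:
  assumes "0 < \<sigma>" "0 < \<delta>"
  shows "measure (density lborel (normal_density 0 \<sigma>)) {\<delta><..} \<le> 3 * \<sigma> ^ 4 / \<delta> ^ 4"
proof -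
  let ?\<mu> = "density lborel (normal_density 0 \<sigma>)"
  interpret prob_space ?\<mu> using assms(1) by (rule prob_space_normal_density)
  have moment: "has_bochner_integral lborel (\<lambda>x. normal_density 0 \<sigma> x * x ^ 4) (3 * \<sigma> ^ 4)"
  proof -
    have eq: "fact (2 * 2) / ((2 / \<sigma>\<^sup>2)\<^sup>2 * fact 2) = 3 * \<sigma> ^ 4"
      using assms by (simp add: fact_numeral power_divide)
    have four: "2 * 2 = (4 :: nat)" by simp
    show ?thesis using normal_moment_even[of \<sigma> 0 2, OF assms(1)] unfolding eq diff_zero unfolding four .
  qed
  have int: "integrable ?\<mu> (\<lambda>x. x ^ 4)" "(LINT x|?\<mu>. x ^ 4) = 3 * \<sigma> ^ 4"
    using moment by (auto simp: integrable_density integral_density has_bochner_integral_iff)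
  have "measure ?\<mu> {\<delta><..} = (LINT x|?\<mu>. indicator {\<delta><..} x)" by simp
  also have "\<dots> \<le> (LINT x|?\<mu>. x ^ 4 / \<delta> ^ 4)"
  proof (rule integral_mono')
    show "integrable ?\<mu> (\<lambda>x. x ^ 4 / \<delta> ^ 4)" using int by simp
    show "indicator {\<delta><..} x \<le> x ^ 4 / \<delta> ^ 4" for x
      using assms power_mono[of \<delta> x 4] by (auto simp: indicator_def)
  qed auto
  finally show ?thesis using int by simp
qed

section \<open>Brownian motion sampled on a grid\<close>

context brownian_motion
begin

definition grid_max :: "real \<Rightarrow> nat \<Rightarrow> 'a \<Rightarrow> real" where
  "grid_max \<eta> K \<omega> = Max ((\<lambda>k. B (real k * \<eta>) \<omega>) ` {..K})"

lemma borel_measurable_grid_max: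
  assumes "0 \<le> \<eta>"
  shows "grid_max \<eta> K \<in> borel_measurable M"
  unfolding grid_max_def[abs_def] using assms by (intro borel_measurable_Max rv) auto

context
  fixes \<eta> :: real
  assumes \<eta>: "0 < \<eta>"
begin

definition "step_law = density lborel (normal_density 0 (sqrt \<eta>))"

interpretation S: symmetric_step step_law
  unfolding step_law_def using \<eta> by (intro symmetric_step_normal) simp

lemma chain_max_step_increments:
  assumes "\<omega> \<in> space M"
  shows "chain max_step (\<lambda>i. B (real (Suc i) * \<eta>) \<omega> - B (real i * \<eta>) \<omega>) (x, x \<le> 0) k
    = (x - B (real k * \<eta>) \<omega>, \<exists>j\<le>k. x \<le> B (real j * \<eta>) \<omega>)"
proof (induction k)
  case 0
  then show ?case using start[OF assms] by simp
next
  case (Suc k)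
  have "max_step (x - a, h) (b - a) = (x - b, h \<or> x \<le> b)" for a b h
    by (simp add: max_step_def)
  then show ?case unfolding chain.simps Suc.IH by (auto simp: le_Suc_eq)
qed

lemma expectation_max_step:
  fixes F :: "real \<times> bool \<Rightarrow> real"
  assumes F: "F \<in> borel_measurable (borel \<Otimes>\<^sub>M count_space UNIV)" "\<And>s. norm (F s) \<le> 1"
  shows "expectation (\<lambda>\<omega>. F (x - B (real K * \<eta>) \<omega>, \<exists>j\<le>K. x \<le> B (real j * \<eta>) \<omega>))
    = (transition max_step step_law ^^ K) F (x, x \<le> 0)"
proof -
  have "expectation (\<lambda>\<omega>. F (chain max_step (\<lambda>i. B (real (Suc i) * \<eta>) \<omega> - B (real i * \<eta>) \<omega>) (x, x \<le> 0) K))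
    = (transition max_step step_law ^^ K) F (x, x \<le> 0)"
  proof (rule expectation_chain[where N = borel and S = "borel \<Otimes>\<^sub>M count_space UNIV"])
    show "indep_vars (\<lambda>_. borel) (\<lambda>i \<omega>. B (real (Suc i) * \<eta>) \<omega> - B (real i * \<eta>) \<omega>) {..<K}"
      using indep \<eta> unfolding indep_increments_def
      by (auto intro!: incseq_SucI mult_right_mono elim!: allE[of _ "\<lambda>i. real i * \<eta>"])
    show "distr M borel (\<lambda>\<omega>. B (real (Suc i) * \<eta>) \<omega> - B (real i * \<eta>) \<omega>) = step_law" for i
      using distributed_distr_eq_density[OF increments[of "real i * \<eta>" "real (Suc i) * \<eta>"]] \<eta>
      by (simp add: step_law_def algebra_simps cong: distr_cong)
    show "case_prod max_step \<in> (borel \<Otimes>\<^sub>M count_space UNIV) \<Otimes>\<^sub>M borel \<rightarrow>\<^sub>M borel \<Otimes>\<^sub>M count_space UNIV"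
      unfolding max_step_def case_prod_beta by measurable
  qed (use F in \<open>auto simp: space_pair_measure S.prob_space_axioms\<close>)
  then show ?thesis
    using chain_max_step_increments by (subst (asm) Bochner_Integration.integral_cong[OF refl]) auto
qed

lemma prob_B_ge: "prob {\<omega> \<in> space M. x \<le> B (real K * \<eta>) \<omega>} = S.sum_ge K x"
proof -
  have [measurable]: "B (real K * \<eta>) \<in> borel_measurable M" using \<eta> by (intro rv) auto
  have "prob {\<omega> \<in> space M. x \<le> B (real K * \<eta>) \<omega>} = expectation (indicator {\<omega> \<in> space M. x \<le> B (real K * \<eta>) \<omega>})"
    by simp
  also have "\<dots> = expectation (\<lambda>\<omega>. (\<lambda>(x, h). if x \<le> 0 then 1 else 0)
      (x - B (real K * \<eta>) \<omega>, \<exists>j\<le>K. x \<le> B (real j * \<eta>) \<omega>))"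
    by (intro Bochner_Integration.integral_cong) (auto simp: indicator_def)
  also have "\<dots> = S.sum_ge K x"
    by (subst expectation_max_step) (auto simp: S.transition_sum_ge)
  finally show ?thesis .
qed

lemma prob_grid_max_ge: "prob {\<omega> \<in> space M. x \<le> grid_max \<eta> K \<omega>} = S.sum_hit K x"
proof -
  have [measurable]: "grid_max \<eta> K \<in> borel_measurable M" using \<eta> by (intro borel_measurable_grid_max) simp
  have "prob {\<omega> \<in> space M. x \<le> grid_max \<eta> K \<omega>} = expectation (indicator {\<omega> \<in> space M. x \<le> grid_max \<eta> K \<omega>})"
    by simp
  also have "\<dots> = expectation (\<lambda>\<omega>. (\<lambda>(x, h). if h then 1 else 0)
      (x - B (real K * \<eta>) \<omega>, \<exists>j\<le>K. x \<le> B (real j * \<eta>) \<omega>))"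
    by (intro Bochner_Integration.integral_cong refl) (auto simp: indicator_def grid_max_def Max_ge_iff)
  also have "\<dots> = S.sum_hit K x"
    using S.transition_sum_hit[where K = K and x = x and h = False]
    by (subst expectation_max_step) auto
  finally show ?thesis .
qed

lemma prob_grid_max_le:
  "prob {\<omega> \<in> space M. x \<le> grid_max \<eta> K \<omega>} \<le> 2 * prob {\<omega> \<in> space M. x \<le> B (real K * \<eta>) \<omega>}"
  unfolding prob_B_ge prob_grid_max_ge by (rule S.sum_hit_le)

lemma prob_B_le_grid_max:
  assumes "0 < x" "0 < \<delta>"
  shows "prob {\<omega> \<in> space M. x + \<delta> \<le> B (real K * \<eta>) \<omega>}
    \<le> 1 / 2 * prob {\<omega> \<in> space M. x \<le> grid_max \<eta> K \<omega>} + real K * (3 * \<eta>\<^sup>2 / \<delta> ^ 4)"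
proof -
  have "sqrt \<eta> ^ 4 = (sqrt \<eta> ^ 2) ^ 2" by simp
  then have "measure step_law {\<delta><..} \<le> 3 * \<eta>\<^sup>2 / \<delta> ^ 4"
    using normal_tail_le[of "sqrt \<eta>" \<delta>] \<eta> assms by (simp add: step_law_def)
  then have "real K * measure step_law {\<delta><..} \<le> real K * (3 * \<eta>\<^sup>2 / \<delta> ^ 4)"
    by (intro mult_left_mono) auto
  then show ?thesis
    unfolding prob_B_ge prob_grid_max_ge using S.sum_ge_le_hit[of x \<delta> K] assms by simp
qed

end

end

text \<open>\<open>r n\<close> and \<open>p n\<close> stand for the tails of the maximum and of the end point: the reflection
  principle up to a small shift \<open>\<gamma>\<close> of the level is enough, because the limit of \<open>p n\<close> is continuous.\<close>

lemma tendsto_reflection_squeeze: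
  fixes r :: "nat \<Rightarrow> real" and p :: "nat \<Rightarrow> real \<Rightarrow> real"
  assumes a: "0 < a"
    and upper: "\<And>\<gamma> n. 0 < \<gamma> \<Longrightarrow> \<gamma> < a \<Longrightarrow> r n \<le> 2 * p n (a - \<gamma>)"
    and lower: "\<And>\<gamma> n. 0 < \<gamma> \<Longrightarrow> p n (a + \<gamma>) \<le> (1 / 2 + e n \<gamma>) * r n"
    and e: "\<And>\<gamma> n. 0 \<le> e n \<gamma>" "\<And>\<gamma>. 0 < \<gamma> \<Longrightarrow> (\<lambda>n. e n \<gamma>) \<longlonglongrightarrow> 0"
    and p: "\<And>x. (\<lambda>n. p n x) \<longlonglongrightarrow> q x" and q: "isCont q a"
    and r: "\<And>n. r n \<le> 1"
  shows "r \<longlonglongrightarrow> 2 * q a"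
proof (rule order_tendstoI)
  have cont: "((\<lambda>x. 2 * q x) \<longlongrightarrow> 2 * q a) (at a)"
    using q by (intro tendsto_intros) (simp add: isCont_def)
  fix y
  { assume "y < 2 * q a"
    from order_tendstoD(1)[OF cont this] obtain d where d: "0 < d" "\<And>x. x \<noteq> a \<Longrightarrow> dist x a < d \<Longrightarrow> y < 2 * q x"
      unfolding eventually_at by auto
    define \<gamma> where "\<gamma> = d / 2"
    have \<gamma>: "0 < \<gamma>" "y < 2 * q (a + \<gamma>)" using d(1) d(2)[of "a + \<gamma>"] by (auto simp: \<gamma>_def dist_real_def)
    have "(\<lambda>n. 2 * p n (a + \<gamma>) - 2 * e n \<gamma>) \<longlonglongrightarrow> 2 * q (a + \<gamma>) - 2 * 0"
      by (intro tendsto_intros p e \<gamma>)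
    from order_tendstoD(1)[OF this, of y] \<gamma>
    have "\<forall>\<^sub>F n in sequentially. y < 2 * p n (a + \<gamma>) - 2 * e n \<gamma>" by simp
    then show "\<forall>\<^sub>F n in sequentially. y < r n"
    proof eventually_elim
      case (elim n)
      \<comment> \<open>\<open>r n \<le> 1\<close> turns the multiplicative error into an additive
        one.\<close>
      have "e n \<gamma> * r n \<le> e n \<gamma> * 1" using e(1) r by (intro mult_left_mono) auto
      then show ?case using elim lower[OF \<gamma>(1), of n] by (simp add: algebra_simps)
    qed }
  { assume "2 * q a < y"
    from order_tendstoD(2)[OF cont this] obtain d where d: "0 < d" "\<And>x. x \<noteq> a \<Longrightarrow> dist x a < d \<Longrightarrow> 2 * q x < y"
      unfolding eventually_at by auto
    \<comment> \<open>The bound \<open>a / 2\<close> keeps \<open>\<gamma>\<close> below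
      \<open>a\<close>, the range in which \<open>upper\<close> is available.\<close>
    define \<gamma> where "\<gamma> = min (d / 2) (a / 2)"
    have \<gamma>: "0 < \<gamma>" "\<gamma> < a" "2 * q (a - \<gamma>) < y"
      using d(1) d(2)[of "a - \<gamma>"] a by (auto simp: \<gamma>_def dist_real_def)
    have "(\<lambda>n. 2 * p n (a - \<gamma>)) \<longlonglongrightarrow> 2 * q (a - \<gamma>)" by (intro tendsto_intros p)
    from order_tendstoD(2)[OF this \<gamma>(3)] show "\<forall>\<^sub>F n in sequentially. r n < y"
      by (rule eventually_mono) (rule order.strict_trans1[OF upper[OF \<gamma>(1,2)]]) }
qed

lemma (in prob_space) prob_gt_eq_cdf:
  assumes X: "X \<in> borel_measurable M"
  shows "prob {\<omega> \<in> space M. a < X \<omega>} = 1 - cdf (law M X) a"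
proof -
  have "{\<omega> \<in> space M. a < X \<omega>} = space M - {\<omega> \<in> space M. X \<omega> \<le> a}" by auto
  moreover have "cdf (law M X) a = prob {\<omega> \<in> space M. X \<omega> \<le> a}"
    unfolding cdf_def law_def using X
    by (subst measure_distr) (auto intro!: arg_cong[where f = prob])
  moreover have "{\<omega> \<in> space M. X \<omega> \<le> a} \<in> events" using X by measurable
  ultimately show ?thesis by (simp add: prob_compl)
qed

context brownian_motion
begin

text \<open>Uniform continuity on the compact interval gives the limit. The one-sided bound holds
  because grid points lie in the interval; it saves an error term when the grid maximum is replaced
  by the running maximum.\<close>

lemma running_max_approx:
  assumes t: "0 < t" and \<omega>: "\<omega> \<in> space M"
  shows "grid_max (t / real (Suc n)) (Suc n) \<omega> \<le> running_max B t \<omega>"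
    and "(\<lambda>n. grid_max (t / real (Suc n)) (Suc n) \<omega>) \<longlonglongrightarrow> running_max B t \<omega>"
proof -
  let ?\<eta> = "\<lambda>n. t / real (Suc n)"
  have cont: "continuous_on {0..t} (\<lambda>s. B s \<omega>)"
    using cont_paths[OF \<omega>] by (rule continuous_on_subset) auto
  have bdd: "bdd_above ((\<lambda>s. B s \<omega>) ` {0..t})"
    using compact_continuous_image[OF cont] by (intro bounded_imp_bdd_above compact_imp_bounded) auto
  have grid: "real k * ?\<eta> n \<in> {0..t}" if "k \<le> Suc n" for k n
    using that t mult_right_mono[of "real k" "real (Suc n)" t] by (auto simp: divide_simps mult.commute simp del: of_nat_Suc)
  show "grid_max (?\<eta> n) (Suc n) \<omega> \<le> running_max B t \<omega>"
    unfolding grid_max_def running_max_def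
    by (intro Max.boundedI) (use grid bdd in \<open>auto intro!: cSUP_upper simp del: of_nat_Suc\<close>)
  show "(\<lambda>n. grid_max (?\<eta> n) (Suc n) \<omega>) \<longlonglongrightarrow> running_max B t \<omega>"
  proof (rule metric_LIMSEQ_I)
    fix e :: real assume e: "0 < e"
    have "uniformly_continuous_on {0..t} (\<lambda>s. B s \<omega>)"
      using cont by (intro compact_uniformly_continuous) auto
    then obtain d where d: "0 < d"
      "\<And>s u. s \<in> {0..t} \<Longrightarrow> u \<in> {0..t} \<Longrightarrow> dist u s < d \<Longrightarrow> dist (B u \<omega>) (B s \<omega>) < e / 2"
      using e unfolding uniformly_continuous_on_def by (metis half_gt_zero)
    have "(\<lambda>n. ?\<eta> n) \<longlonglongrightarrow> 0" using mesh_tendsto_zero[of 1 t 1] by simp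
    from order_tendstoD(2)[OF this d(1)] obtain n0 where n0: "\<And>n. n \<ge> n0 \<Longrightarrow> ?\<eta> n < d"
      unfolding eventually_sequentially by blast
    have "dist (grid_max (?\<eta> n) (Suc n) \<omega>) (running_max B t \<omega>) < e" if "n \<ge> n0" for n
    proof -
      define \<eta> where "\<eta> = ?\<eta> n"
      have \<eta>: "0 < \<eta>" "\<eta> < d" "real (Suc n) * \<eta> = t" using t n0[OF that] by (auto simp: \<eta>_def)
      have "\<bar>(SUP s\<in>{0..t}. B s \<omega>) - Max ((\<lambda>k. B (real k * \<eta>) \<omega>) ` {..Suc n})\<bar> \<le> e / 2"
      proof (rule abs_SUP_minus_Max_le)
        fix s assume s: "s \<in> {0..t}"
        define k where "k = nat \<lfloor>s / \<eta>\<rfloor>"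
        have k: "real k \<le> s / \<eta>" "s / \<eta> < real k + 1" using s \<eta> by (auto simp: k_def)
        then have ks: "real k * \<eta> \<le> s" "s - real k * \<eta> < \<eta>" using \<eta>(1) by (auto simp: field_simps)
        then have "real k * \<eta> \<le> real (Suc n) * \<eta>" using s \<eta>(3) by auto
        then have kn: "k \<le> Suc n" using \<eta>(1) by (simp only: mult_le_cancel_right_pos of_nat_le_iff)
        have "dist (B s \<omega>) (B (real k * \<eta>) \<omega>) < e / 2"
          using grid[OF kn, folded \<eta>_def] s ks \<eta> by (intro d(2)) (auto simp: dist_real_def)
        then have "B s \<omega> \<le> B (real k * \<eta>) \<omega> + e / 2" unfolding dist_real_def by linarith
        then show "\<exists>k\<in>{..Suc n}. B s \<omega> \<le> B (real k * \<eta>) \<omega> + e / 2" using kn by blast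
      next
        fix k assume "k \<in> {..Suc n}"
        then show "\<exists>s\<in>{0..t}. B (real k * \<eta>) \<omega> \<le> B s \<omega> + e / 2"
          using grid[of k n, folded \<eta>_def] e by (intro bexI[of _ "real k * \<eta>"]) auto
      qed (use t in auto)
      then show ?thesis
        using e by (simp add: dist_real_def abs_minus_commute grid_max_def running_max_def \<eta>_def)
    qed
    then show "\<exists>n0. \<forall>n\<ge>n0. dist (grid_max (?\<eta> n) (Suc n) \<omega>) (running_max B t \<omega>) < e" by blast
  qed
qed

lemma borel_measurable_running_max:
  assumes "0 < t"
  shows "running_max B t \<in> borel_measurable M"
  by (rule borel_measurable_LIMSEQ_real[OF running_max_approx(2)[OF assms] borel_measurable_grid_max])
     (use assms in auto)

context
  fixes t :: real
  assumes t: "0 < t"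
begin

lemma prob_running_max_le:
  assumes "0 < \<gamma>"
  shows "prob {\<omega> \<in> space M. a < running_max B t \<omega>} \<le> 2 * prob {\<omega> \<in> space M. a - \<gamma> < B t \<omega>}"
proof -
  let ?R = "running_max B t"
  define G where "G n = grid_max (t / real (Suc n)) (Suc n)" for n
  have [measurable]: "?R \<in> borel_measurable M" "G n \<in> borel_measurable M" "B t \<in> borel_measurable M" for n
    unfolding G_def using t by (simp_all add: borel_measurable_running_max borel_measurable_grid_max rv)
  define err where "err n = prob {\<omega> \<in> space M. ?R \<omega> - G n \<omega> > \<gamma> / 2}" for n
  have err: "err \<longlonglongrightarrow> 0"
    unfolding err_def
  proof (rule prob_gt_tendsto_zero)
    show "(\<lambda>n. ?R \<omega> - G n \<omega>) \<longlonglongrightarrow> 0" if "\<omega> \<in> space M" for \<omega>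
      using tendsto_diff[OF tendsto_const running_max_approx(2)[OF t that], of "?R \<omega>"] by (simp add: G_def)
  qed (use assms in auto)
  have le: "prob {\<omega> \<in> space M. a < ?R \<omega>} \<le> 2 * prob {\<omega> \<in> space M. a - \<gamma> < B t \<omega>} + err n" for n
  proof -
    have "prob {\<omega> \<in> space M. a < ?R \<omega>}
        \<le> prob ({\<omega> \<in> space M. a - \<gamma> / 2 \<le> G n \<omega>} \<union> {\<omega> \<in> space M. ?R \<omega> - G n \<omega> > \<gamma> / 2})"
      by (intro finite_measure_mono) auto
    also have "\<dots> \<le> prob {\<omega> \<in> space M. a - \<gamma> / 2 \<le> G n \<omega>} + err n"
      unfolding err_def by (intro measure_Un_le) auto
    also have "prob {\<omega> \<in> space M. a - \<gamma> / 2 \<le> G n \<omega>} \<le> 2 * prob {\<omega> \<in> space M. a - \<gamma> / 2 \<le> B t \<omega>}"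
      using prob_grid_max_le[of "t / real (Suc n)" "a - \<gamma> / 2" "Suc n"] t by (simp add: G_def)
    also have "prob {\<omega> \<in> space M. a - \<gamma> / 2 \<le> B t \<omega>} \<le> prob {\<omega> \<in> space M. a - \<gamma> < B t \<omega>}"
      using assms by (intro finite_measure_mono) auto
    finally show ?thesis by simp
  qed
  have "(\<lambda>n. 2 * prob {\<omega> \<in> space M. a - \<gamma> < B t \<omega>} + err n) \<longlonglongrightarrow> 2 * prob {\<omega> \<in> space M. a - \<gamma> < B t \<omega>} + 0"
    by (intro tendsto_intros err)
  from LIMSEQ_le_const[OF this] le show ?thesis by auto
qed

lemma prob_end_le_running_max:
  assumes "0 < \<gamma>" "0 < a"
  shows "prob {\<omega> \<in> space M. a + \<gamma> < B t \<omega>} \<le> 1 / 2 * prob {\<omega> \<in> space M. a < running_max B t \<omega>}"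
proof -
  let ?R = "running_max B t"
  define G where "G n = grid_max (t / real (Suc n)) (Suc n)" for n
  have [measurable]: "?R \<in> borel_measurable M" "G n \<in> borel_measurable M" "B t \<in> borel_measurable M" for n
    unfolding G_def using t by (simp_all add: borel_measurable_running_max borel_measurable_grid_max rv)
  \<comment> \<open>From the union bound over \<open>n + 1\<close> steps: one factor of the squared
    cell length combines with \<open>n + 1\<close> to \<open>t\<close>, the other remains and tends
    to 0.\<close>
  define C where "C = t * (3 / (\<gamma> / 2) ^ 4)"
  have le: "prob {\<omega> \<in> space M. a + \<gamma> < B t \<omega>} \<le> 1 / 2 * prob {\<omega> \<in> space M. a < ?R \<omega>} + C * (t / real (Suc n))" for n
  proof -
    define \<eta> where "\<eta> = t / real (Suc n)"
    have \<eta>: "0 < \<eta>" "real (Suc n) * \<eta> = t" using t by (auto simp: \<eta>_def)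
    have "prob {\<omega> \<in> space M. a + \<gamma> < B t \<omega>} \<le> prob {\<omega> \<in> space M. (a + \<gamma> / 2) + \<gamma> / 2 \<le> B t \<omega>}"
      by (intro finite_measure_mono) auto
    also have "\<dots> \<le> 1 / 2 * prob {\<omega> \<in> space M. a + \<gamma> / 2 \<le> G n \<omega>} + real (Suc n) * (3 * \<eta>\<^sup>2 / (\<gamma> / 2) ^ 4)"
      using prob_B_le_grid_max[OF \<eta>(1), of "a + \<gamma> / 2" "\<gamma> / 2" "Suc n"] assms
      unfolding \<eta>(2) G_def \<eta>_def[symmetric] by simp
    also have "real (Suc n) * (3 * \<eta>\<^sup>2 / (\<gamma> / 2) ^ 4) = (real (Suc n) * \<eta>) * (3 / (\<gamma> / 2) ^ 4) * \<eta>"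
      by (simp add: power2_eq_square)
    also have "\<dots> = C * \<eta>" unfolding \<eta>(2) C_def ..
    also have "prob {\<omega> \<in> space M. a + \<gamma> / 2 \<le> G n \<omega>} \<le> prob {\<omega> \<in> space M. a < ?R \<omega>}"
    proof (rule finite_measure_mono)
      show "{\<omega> \<in> space M. a + \<gamma> / 2 \<le> G n \<omega>} \<subseteq> {\<omega> \<in> space M. a < ?R \<omega>}"
      proof safe
        fix \<omega> assume "\<omega> \<in> space M" "a + \<gamma> / 2 \<le> G n \<omega>"
        then show "a < ?R \<omega>"
          using running_max_approx(1)[OF t, of \<omega> n] assms(1) unfolding G_def by linarith
      qed
    qed measurable
    finally show ?thesis by (simp add: \<eta>_def)
  qed
  have "(\<lambda>n. 1 / 2 * prob {\<omega> \<in> space M. a < ?R \<omega>} + C * (t / real (Suc n))) \<longlonglongrightarrow> 1 / 2 * prob {\<omega> \<in> space M. a < ?R \<omega>} + 0"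
    using mesh_tendsto_zero[of C t 1] by (intro tendsto_intros) simp
  from LIMSEQ_le_const[OF this] le show ?thesis by auto
qed

lemma distributed_B: "distributed M lborel (B t) (normal_density 0 (sqrt t))"
proof -
  have "distr M lborel (B t) = distr M lborel (\<lambda>\<omega>. B t \<omega> - B 0 \<omega>)"
    by (rule distr_cong) (auto simp: start)
  then show ?thesis
    using increments[of 0 t] t rv[of t] by (simp add: distributed_def)
qed

lemma isCont_prob_B_gt: "isCont (\<lambda>a. prob {\<omega> \<in> space M. a < B t \<omega>}) a"
proof -
  have B: "B t \<in> borel_measurable M" using t by (intro rv) simp
  interpret law: real_distribution "law M (B t)" unfolding law_def using B by (rule real_distribution_distr)
  have "law M (B t) = density lborel (normal_density 0 (sqrt t))"
    using distributed_distr_eq_density[OF distributed_B] unfolding law_def by (simp cong: distr_cong)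
  then have "emeasure (law M (B t)) {a} = 0"
    by (simp add: emeasure_density nn_integral_indicator_singleton)
  then have "isCont (cdf (law M (B t))) a"
    unfolding law.isCont_cdf by (simp add: measure_def)
  then show ?thesis unfolding prob_gt_eq_cdf[OF B] by (intro continuous_intros)
qed

lemma char_B: "char (law M (B t)) \<xi> = of_real (exp (- (\<xi>\<^sup>2 * t / 2)))"
proof -
  have B [measurable]: "B t \<in> borel_measurable M" using t by (intro rv) simp
  have "distributed M lborel (\<lambda>\<omega>. (B t \<omega> - 0) / sqrt t) std_normal_density"
    using distributed_B normal_standard_normal_convert[of "sqrt t" "B t" 0] t by simp
  from distributed_distr_eq_density[OF this]
  have Z: "distr M borel (\<lambda>\<omega>. B t \<omega> / sqrt t) = std_normal_distribution"
    by (simp cong: distr_cong)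
  have "char (law M (B t)) \<xi> = expectation (\<lambda>\<omega>. iexp (\<xi> * B t \<omega>))"
    unfolding char_def law_def by (subst integral_distr) auto
  also have "\<dots> = expectation (\<lambda>\<omega>. iexp ((\<xi> * sqrt t) * (B t \<omega> / sqrt t)))"
    using t by simp
  also have "\<dots> = char (distr M borel (\<lambda>\<omega>. B t \<omega> / sqrt t)) (\<xi> * sqrt t)"
    unfolding char_def by (subst integral_distr) auto
  finally show ?thesis
    unfolding Z char_std_normal_distribution using t by (simp add: power_mult_distrib)
qed

text \<open>For Brownian motion the shifted inequalities carry no further error, so the squeeze with
  constant sequences and error 0 yields an identity.\<close>

lemma prob_running_max_gt:
  assumes a: "0 < a"
  shows "prob {\<omega> \<in> space M. a < running_max B t \<omega>} = 2 * prob {\<omega> \<in> space M. a < B t \<omega>}"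
proof -
  have "(\<lambda>n::nat. prob {\<omega> \<in> space M. a < running_max B t \<omega>}) \<longlonglongrightarrow> 2 * prob {\<omega> \<in> space M. a < B t \<omega>}"
  proof (rule tendsto_reflection_squeeze[where q = "\<lambda>a. prob {\<omega> \<in> space M. a < B t \<omega>}"
        and p = "\<lambda>n a. prob {\<omega> \<in> space M. a < B t \<omega>}" and e = "\<lambda>_ _. 0", OF a])
    show "prob {\<omega> \<in> space M. a + \<gamma> < B t \<omega>} \<le> (1 / 2 + 0) * prob {\<omega> \<in> space M. a < running_max B t \<omega>}"
      if "0 < \<gamma>" for \<gamma>
      using prob_end_le_running_max[OF that a] by simp
  qed (simp_all add: prob_running_max_le isCont_prob_B_gt)
  then show ?thesis by (simp add: LIMSEQ_const_iff)
qed

end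

end

section \<open>Convergence\<close>

text \<open>A single step suffices: the maximum over the times 0 and \<open>t\<close> is nonnegative
  because \<open>B 0\<close> vanishes, so \<open>prob_grid_max_le\<close> at level 0 settles the
  closed event. Continuity of the tail passes to the open one.\<close>

lemma (in brownian_motion) prob_B_gt_zero_ge_half:
  assumes t: "0 < t"
  shows "1 / 2 \<le> prob {\<omega> \<in> space M. 0 < B t \<omega>}"
proof -
  have [measurable]: "B t \<in> borel_measurable M" using t by (intro rv) simp
  have "{\<omega> \<in> space M. 0 \<le> grid_max t 1 \<omega>} = space M"
  proof -
    have "0 \<le> grid_max t 1 \<omega>" if "\<omega> \<in> space M" for \<omega>
    proof -
      have "B (real 0 * t) \<omega> \<le> grid_max t 1 \<omega>"
        unfolding grid_max_def by (rule Max_ge[OF _ imageI]) auto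
      then show ?thesis using start[OF that] by simp
    qed
    then show ?thesis by auto
  qed
  then have half: "1 / 2 \<le> prob {\<omega> \<in> space M. 0 \<le> B t \<omega>}"
    using prob_grid_max_le[OF t, of 0 1] by (simp add: prob_space)
  have "((\<lambda>y. prob {\<omega> \<in> space M. y < B t \<omega>}) \<longlongrightarrow> prob {\<omega> \<in> space M. 0 < B t \<omega>}) (at_left 0)"
    by (rule continuous_at_imp_continuous_at_within[OF isCont_prob_B_gt[OF t], unfolded continuous_within])
  moreover have "\<forall>\<^sub>F y in at_left 0. 1 / 2 \<le> prob {\<omega> \<in> space M. y < B t \<omega>}"
    unfolding eventually_at_filter
  proof (intro always_eventually allI impI)
    fix y :: real assume "y \<in> {..<0}"
    then have "prob {\<omega> \<in> space M. 0 \<le> B t \<omega>} \<le> prob {\<omega> \<in> space M. y < B t \<omega>}"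
      by (intro finite_measure_mono) auto
    then show "1 / 2 \<le> prob {\<omega> \<in> space M. y < B t \<omega>}" using half by linarith
  qed
  ultimately show ?thesis by (rule tendsto_lowerbound) simp
qed

text \<open>\<open>\<nu> n\<close> is a difference of two large terms. Rationalising gives
  \<open>\<xi>^2 * (c^2 / rate) / (1 + sqrt (1 - \<xi>^2 * (c / rate)^2))\<close>, where
  \<open>c^2 / rate\<close> tends to 1 and \<open>c / rate\<close> to 0. The first claim makes the
  root real.\<close>

lemma telegraph_char_limits:
  fixes c rate :: "nat \<Rightarrow> real" and \<xi> :: real
  assumes c: "filterlim c at_top sequentially" and rate: "filterlim rate at_top sequentially"
    and ratio: "(\<lambda>n. rate n / (c n)\<^sup>2) \<longlonglongrightarrow> 1"
  defines "\<nu> \<equiv> \<lambda>n. rate n - sqrt ((rate n)\<^sup>2 - (\<xi> * c n)\<^sup>2)"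
  shows "\<forall>\<^sub>F n in sequentially. (\<xi> * c n)\<^sup>2 \<le> (rate n)\<^sup>2" "\<nu> \<longlonglongrightarrow> \<xi>\<^sup>2 / 2"
proof -
  have pos: "\<forall>\<^sub>F n in sequentially. 0 < c n" "\<forall>\<^sub>F n in sequentially. 0 < rate n"
    using c rate by (auto simp: filterlim_at_top_dense)
  have u: "(\<lambda>n. (c n)\<^sup>2 / rate n) \<longlonglongrightarrow> 1"
    using tendsto_inverse[OF ratio] by simp
  have "(\<lambda>n. (c n)\<^sup>2 / rate n * inverse (c n)) \<longlonglongrightarrow> 1 * 0"
    by (intro tendsto_mult u tendsto_inverse_0_at_top c)
  moreover have "\<forall>\<^sub>F n in sequentially. (c n)\<^sup>2 / rate n * inverse (c n) = c n / rate n"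
    using pos(1) by eventually_elim (simp add: field_simps power2_eq_square)
  ultimately have w: "(\<lambda>n. c n / rate n) \<longlonglongrightarrow> 0"
    by (auto intro: Lim_transform_eventually)
  have sq: "(\<lambda>n. 1 - \<xi>\<^sup>2 * (c n / rate n)\<^sup>2) \<longlonglongrightarrow> 1 - \<xi>\<^sup>2 * 0\<^sup>2"
    by (intro tendsto_intros w)
  then have "\<forall>\<^sub>F n in sequentially. 0 < 1 - \<xi>\<^sup>2 * (c n / rate n)\<^sup>2"
    using order_tendstoD(1)[OF sq, of 0] by simp
  then have ge: "\<forall>\<^sub>F n in sequentially. 0 < 1 - \<xi>\<^sup>2 * (c n / rate n)\<^sup>2 \<and> (\<xi> * c n)\<^sup>2 \<le> (rate n)\<^sup>2"
    using pos(2)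
  proof eventually_elim
    case (elim n)
    then have "\<xi>\<^sup>2 * (c n / rate n)\<^sup>2 * (rate n)\<^sup>2 \<le> 1 * (rate n)\<^sup>2" by (intro mult_right_mono) auto
    then show ?case using elim by (simp add: power_divide power_mult_distrib)
  qed
  then show "\<forall>\<^sub>F n in sequentially. (\<xi> * c n)\<^sup>2 \<le> (rate n)\<^sup>2" by (rule eventually_mono) simp
  have lim: "(\<lambda>n. \<xi>\<^sup>2 * ((c n)\<^sup>2 / rate n) / (1 + sqrt (1 - \<xi>\<^sup>2 * (c n / rate n)\<^sup>2)))
      \<longlonglongrightarrow> \<xi>\<^sup>2 * 1 / (1 + sqrt (1 - \<xi>\<^sup>2 * 0\<^sup>2))"
    by (intro tendsto_intros u w) simp
  have "\<forall>\<^sub>F n in sequentially. \<xi>\<^sup>2 * ((c n)\<^sup>2 / rate n) / (1 + sqrt (1 - \<xi>\<^sup>2 * (c n / rate n)\<^sup>2)) = \<nu> n"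
    using ge pos(2)
  proof eventually_elim
    case (elim n)
    define s where "s = sqrt (1 - \<xi>\<^sup>2 * (c n / rate n)\<^sup>2)"
    have s: "0 < s" "s\<^sup>2 = 1 - \<xi>\<^sup>2 * (c n / rate n)\<^sup>2" using elim by (auto simp: s_def)
    have "(rate n)\<^sup>2 - (\<xi> * c n)\<^sup>2 = (rate n * s)\<^sup>2"
      using s(2) elim by (simp add: power_mult_distrib power_divide field_simps)
    then have "sqrt ((rate n)\<^sup>2 - (\<xi> * c n)\<^sup>2) = rate n * s"
      using elim s(1) by (intro real_sqrt_unique) auto
    then have "\<nu> n = rate n * (1 - s)" by (simp add: \<nu>_def algebra_simps)
    moreover have "\<xi>\<^sup>2 * ((c n)\<^sup>2 / rate n) = rate n * (1 - s\<^sup>2)"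
      unfolding s(2) using elim by (simp add: power_divide field_simps power2_eq_square)
    moreover have "1 - s\<^sup>2 = (1 - s) * (1 + s)" by (simp add: algebra_simps power2_eq_square)
    ultimately show ?case unfolding s_def[symmetric] using s(1) by simp
  qed
  from Lim_transform_eventually[OF lim this] show "\<nu> \<longlonglongrightarrow> \<xi>\<^sup>2 / 2" by simp
qed

lemma weak_conv_telegraph_end:
  fixes M :: "nat \<Rightarrow> 'a measure" and c rate :: "nat \<Rightarrow> real"
  assumes t: "0 < t"
    and poisson: "\<And>n. poisson_process (M n) (rate n) (N n)" and c_pos: "\<And>n. 0 < c n"
    and B: "brownian_motion P B"
    and rate: "filterlim rate at_top sequentially" and c: "filterlim c at_top sequentially"
    and ratio: "(\<lambda>n. rate n / (c n)\<^sup>2) \<longlonglongrightarrow> 1"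
  shows "weak_conv_m (\<lambda>n. law (M n) (telegraph (\<lambda>_. c n) (N n) t)) (law P (B t))"
proof (rule levy_continuity)
  interpret P: brownian_motion P B by (rule B)
  let ?\<mu> = "\<lambda>n. law (M n) (telegraph (\<lambda>_. c n) (N n) t)"
  show dist: "real_distribution (?\<mu> n)" for n
  proof -
    interpret poisson_process "M n" "rate n" "N n" by (rule poisson)
    show ?thesis
      unfolding law_def by (rule real_distribution_distr[OF borel_measurable_telegraph_end[OF t c_pos]])
  qed
  show "real_distribution (law P (B t))"
    unfolding law_def using t by (intro P.real_distribution_distr P.rv) simp
  fix \<xi> :: real
  show "(\<lambda>n. char (?\<mu> n) \<xi>) \<longlonglongrightarrow> char (law P (B t)) \<xi>"
  proof (cases "\<xi> = 0")
    \<comment> \<open>The construction of \<open>\<kappa>\<close> divides by \<open>\<xi>\<close>;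
      at frequency 0 both characteristic functions are 1.\<close>
    case True
    then show ?thesis using real_distribution.char_zero[OF dist] P.char_B[OF t] by simp
  next
    case False
    define \<nu> where "\<nu> n = rate n - sqrt ((rate n)\<^sup>2 - (\<xi> * c n)\<^sup>2)" for n
    \<comment> \<open>The first eigenvalue equation solved for \<open>\<kappa>\<close>; the second
      then becomes the quadratic equation for \<open>\<nu>\<close>. As \<open>\<nu>\<close>
      converges and \<open>c\<close> tends to infinity, \<open>\<kappa>\<close> vanishes in the
      limit.\<close>
    define \<kappa> where "\<kappa> n = \<i> * of_real (\<nu> n / (\<xi> * c n))" for n
    note limits = telegraph_char_limits[OF c rate ratio, of \<xi>, folded \<nu>_def[abs_def]]
    have "(\<lambda>n. \<nu> n / \<xi> * inverse (c n)) \<longlonglongrightarrow> \<xi>\<^sup>2 / 2 / \<xi> * 0"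
      using False by (intro tendsto_mult tendsto_divide limits tendsto_const tendsto_inverse_0_at_top c)
    then have "(\<lambda>n. \<nu> n / (\<xi> * c n)) \<longlonglongrightarrow> 0"
      by (simp only: divide_inverse inverse_mult_distrib mult.assoc mult_zero_right)
    then have "(\<lambda>n. complex_of_real (\<nu> n / (\<xi> * c n))) \<longlonglongrightarrow> of_real 0" by (rule tendsto_of_real)
    then have \<kappa>: "\<kappa> \<longlonglongrightarrow> 0"
      unfolding \<kappa>_def[abs_def] using tendsto_mult[OF tendsto_const[of \<i>]] by fastforce
    have "(\<lambda>n. char (?\<mu> n) \<xi> - of_real (exp (- (\<nu> n * t))) * (1 + \<kappa> n)) \<longlonglongrightarrow> 0"
    proof (rule Lim_null_comparison)
      show "(\<lambda>n. norm (\<kappa> n)) \<longlonglongrightarrow> 0" using tendsto_norm[OF \<kappa>] by simp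
      show "\<forall>\<^sub>F n in sequentially. norm (char (?\<mu> n) \<xi> - of_real (exp (- (\<nu> n * t))) * (1 + \<kappa> n)) \<le> norm (\<kappa> n)"
        using limits(1)
      proof eventually_elim
        case (elim n)
        interpret poisson_process "M n" "rate n" "N n" by (rule poisson)
        have s: "(sqrt ((rate n)\<^sup>2 - (\<xi> * c n)\<^sup>2))\<^sup>2 = (rate n)\<^sup>2 - (\<xi> * c n)\<^sup>2"
          using elim by simp
        have "sqrt ((rate n)\<^sup>2 - (\<xi> * c n)\<^sup>2) \<le> sqrt ((rate n)\<^sup>2)" by (intro real_sqrt_le_mono) simp
        then have \<nu>: "0 \<le> \<nu> n" using rate_pos by (simp add: \<nu>_def)
        have \<nu>2: "\<nu> n * \<nu> n = 2 * rate n * \<nu> n - (\<xi> * c n) * (\<xi> * c n)"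
          using s by (simp add: \<nu>_def power2_eq_square algebra_simps)
        have nz: "\<xi> * c n \<noteq> 0" using False c_pos[of n] by simp
        have "\<nu> n * (\<nu> n / (\<xi> * c n)) = 2 * rate n * (\<nu> n / (\<xi> * c n)) - \<xi> * c n"
          using \<nu>2 nz by (simp add: field_simps)
        then have "\<i> * complex_of_real (\<nu> n * (\<nu> n / (\<xi> * c n))) = \<i> * complex_of_real (2 * rate n * (\<nu> n / (\<xi> * c n)) - \<xi> * c n)"
          by (simp only:)
        then have 2: "of_real (\<nu> n) * \<kappa> n = 2 * of_real (rate n) * \<kappa> n - \<i> * of_real (\<xi> * c n)"
          unfolding \<kappa>_def of_real_mult of_real_diff of_real_numeral right_diff_distrib by (simp only: mult_ac)
        have 1: "of_real (\<nu> n) = - (\<i> * of_real (\<xi> * c n) * \<kappa> n)"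
        proof -
          have "- (\<i> * of_real (\<xi> * c n) * \<kappa> n) = of_real ((\<xi> * c n) * (\<nu> n / (\<xi> * c n)))"
            unfolding \<kappa>_def of_real_mult by (simp add: mult_ac)
          also have "(\<xi> * c n) * (\<nu> n / (\<xi> * c n)) = \<nu> n" using nz by simp
          finally show ?thesis by simp
        qed
        show ?case by (rule char_telegraph_end[OF t c_pos \<nu> 1 2])
      qed
    qed
    moreover have "(\<lambda>n. complex_of_real (exp (- (\<nu> n * t))) * (1 + \<kappa> n)) \<longlonglongrightarrow> of_real (exp (- (\<xi>\<^sup>2 / 2 * t))) * (1 + 0)"
      by (intro tendsto_intros limits(2) \<kappa>)
    ultimately have "(\<lambda>n. char (?\<mu> n) \<xi>) \<longlonglongrightarrow> of_real (exp (- (\<xi>\<^sup>2 / 2 * t))) * (1 + 0)"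
      by (rule Lim_transform[rotated])
    then show ?thesis by (simp add: P.char_B[OF t])
  qed
qed

theorem mainTheorem5:
  fixes t :: real
    and c rate :: "nat \<Rightarrow> real"
    and M :: "nat \<Rightarrow> 'a measure"
    and V0 :: "nat \<Rightarrow> 'a \<Rightarrow> real"
    and N :: "nat \<Rightarrow> real \<Rightarrow> 'a \<Rightarrow> nat"
    and P :: "'b measure"
    and B :: "real \<Rightarrow> 'b \<Rightarrow> real"
  assumes "0 < t"
    and "\<And>n. symmetric_telegraph (M n) (c n) (rate n) (V0 n) (N n)"
    and "brownian_motion P B"
    and "filterlim rate at_top sequentially"
    and "filterlim c at_top sequentially"
    and "(\<lambda>n. rate n / (c n)\<^sup>2) \<longlonglongrightarrow> 1"
  shows "weak_conv_m
    (\<lambda>n. cond_law (M n) (\<lambda>\<omega>. V0 n \<omega> = c n) (running_max (telegraph (V0 n) (N n)) t))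
    (law P (running_max B t))"
proof -
  note t = assms(1)
  interpret T: symmetric_telegraph "M n" "c n" "rate n" "V0 n" "N n" for n by (rule assms(2))
  interpret P: brownian_motion P B by (rule assms(3))
  let ?T = "\<lambda>n. telegraph (\<lambda>_. c n) (N n) t" and ?R = "\<lambda>n. running_max (telegraph (\<lambda>_. c n) (N n)) t"
  let ?RB = "running_max B t"
  let ?p = "\<lambda>n a. measure (M n) {\<omega> \<in> space (M n). a < ?T n \<omega>}" and ?r = "\<lambda>n a. measure (M n) {\<omega> \<in> space (M n). a < ?R n \<omega>}"
  let ?q = "\<lambda>a. measure P {\<omega> \<in> space P. a < B t \<omega>}" and ?rB = "\<lambda>a. measure P {\<omega> \<in> space P. a < ?RB \<omega>}"
  have meas: "?T n \<in> borel_measurable (M n)" "?R n \<in> borel_measurable (M n)" for n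
    using T.borel_measurable_telegraph_end[OF t T.speed_pos] T.borel_measurable_telegraph_max[OF t T.speed_pos] .
  have B: "B t \<in> borel_measurable P" using t by (intro P.rv) simp
  have RB: "?RB \<in> borel_measurable P" by (rule P.borel_measurable_running_max[OF t])
  interpret LB: real_distribution "law P (B t)" unfolding law_def by (rule P.real_distribution_distr[OF B])
  interpret LRB: real_distribution "law P ?RB" unfolding law_def by (rule P.real_distribution_distr[OF RB])
  interpret LR: real_distribution "law (M n) (?R n)" for n unfolding law_def by (rule T.real_distribution_distr[OF meas(2)])
  have end_conv: "(\<lambda>n. ?p n x) \<longlonglongrightarrow> ?q x" for x
  proof -
    have "weak_conv_m (\<lambda>n. law (M n) (?T n)) (law P (B t))"
      by (rule weak_conv_telegraph_end[OF t T.poisson_process_axioms T.speed_pos assms(3-6)])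
    moreover have "isCont (cdf (law P (B t))) x"
    proof -
      have "isCont (\<lambda>a. 1 - ?q a) x" by (intro continuous_intros P.isCont_prob_B_gt[OF t])
      moreover have "(\<lambda>a. 1 - ?q a) = cdf (law P (B t))" by (simp add: P.prob_gt_eq_cdf[OF B] fun_eq_iff)
      ultimately show ?thesis by simp
    qed
    ultimately have "(\<lambda>n. cdf (law (M n) (?T n)) x) \<longlonglongrightarrow> cdf (law P (B t)) x"
      by (simp add: weak_conv_m_def weak_conv_def)
    then show ?thesis
      unfolding P.prob_gt_eq_cdf[OF B] T.prob_gt_eq_cdf[OF meas(1)] by (intro tendsto_intros)
  qed
  \<comment> \<open>\<open>rate / c\<close> is \<open>(rate / c^2) * c\<close> and tends to
    infinity, so on every fixed spatial scale a run without reversal becomes negligible.\<close>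
  have ratio: "(\<lambda>n. exp (- (rate n * \<gamma> / (4 * c n)))) \<longlonglongrightarrow> 0" if \<gamma>: "0 < \<gamma>" for \<gamma>
  proof -
    have "filterlim (\<lambda>n. rate n / (c n)\<^sup>2 * c n) at_top sequentially"
      by (rule filterlim_tendsto_pos_mult_at_top[OF assms(6) _ assms(5)]) simp
    then have "filterlim (\<lambda>n. (\<gamma> / 4) * (rate n / (c n)\<^sup>2 * c n)) at_top sequentially"
      using \<gamma> by (intro filterlim_tendsto_pos_mult_at_top[OF tendsto_const]) auto
    moreover have "(\<gamma> / 4) * (rate n / (c n)\<^sup>2 * c n) = rate n * \<gamma> / (4 * c n)" for n
      using T.speed_pos[of n] by (simp add: field_simps power2_eq_square)
    ultimately have "filterlim (\<lambda>n. rate n * \<gamma> / (4 * c n)) at_top sequentially" by simp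
    then have "filterlim (\<lambda>n. - (rate n * \<gamma> / (4 * c n))) at_bot sequentially"
      by (simp add: filterlim_uminus_at_top)
    then show ?thesis by (rule filterlim_compose[OF exp_at_bot])
  qed
  have tail: "(\<lambda>n. ?r n a) \<longlonglongrightarrow> ?rB a" if a: "0 < a" for a
  proof -
    have "(\<lambda>n. ?r n a) \<longlonglongrightarrow> 2 * ?q a"
      by (rule tendsto_reflection_squeeze[where p = ?p and e = "\<lambda>n \<gamma>. exp (- (rate n * \<gamma> / (4 * c n)))", OF a
            T.prob_telegraph_max_le[OF t T.speed_pos] T.prob_telegraph_end_le[OF t T.speed_pos _ a] _ ratio
            end_conv P.isCont_prob_B_gt[OF t]]) simp_all
    then show ?thesis using P.prob_running_max_gt[OF t a] by simp
  qed
  have cdf_pos: "(\<lambda>n. cdf (law (M n) (?R n)) x) \<longlonglongrightarrow> cdf (law P ?RB) x" if x: "0 < x" for x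
    using tendsto_diff[OF tendsto_const[of 1] tail[OF x]]
    unfolding P.prob_gt_eq_cdf[OF RB] T.prob_gt_eq_cdf[OF meas(2)] by simp
  \<comment> \<open>Convergence is obtained at every \<open>x\<close>. For \<open>x \<le> 0\<close>
    the limit is 0: it is bounded by \<open>1 - 2 * ?q y\<close> for every \<open>y > 0\<close>, and
    this falls below any positive number as \<open>y\<close> decreases to 0.\<close>
  have "(\<lambda>n. cdf (law (M n) (?R n)) x) \<longlonglongrightarrow> cdf (law P ?RB) x" for x
  proof (cases "0 < x")
    case False
    have small: "\<exists>y>0. cdf (law P ?RB) y < \<epsilon>" if "0 < \<epsilon>" for \<epsilon>
    proof -
      have "((\<lambda>y. 1 - 2 * ?q y) \<longlongrightarrow> 1 - 2 * ?q 0) (at_right 0)"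
        by (intro tendsto_intros continuous_at_imp_continuous_at_within[OF P.isCont_prob_B_gt[OF t], unfolded continuous_within])
      moreover have "1 - 2 * ?q 0 < \<epsilon>" using P.prob_B_gt_zero_ge_half[OF t] that by simp
      ultimately have "\<forall>\<^sub>F y in at_right 0. 1 - 2 * ?q y < \<epsilon>" by (rule order_tendstoD(2))
      then obtain b where b: "0 < b" "\<And>y. 0 < y \<Longrightarrow> y < b \<Longrightarrow> 1 - 2 * ?q y < \<epsilon>"
        unfolding eventually_at_right_field by auto
      have "0 < b / 2" "1 - 2 * ?q (b / 2) < \<epsilon>" using b(1) by (simp, intro b(2)) auto
      then have "0 < b / 2 \<and> cdf (law P ?RB) (b / 2) < \<epsilon>"
        using P.prob_running_max_gt[OF t \<open>0 < b / 2\<close>] P.prob_gt_eq_cdf[OF RB, of "b / 2"] by linarith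
      then show ?thesis by blast
    qed
    have le: "cdf (law P ?RB) x \<le> 0 + \<epsilon>" if \<epsilon>: "0 < \<epsilon>" for \<epsilon>
    proof -
      obtain y where "0 < y" "cdf (law P ?RB) y < \<epsilon>" using small[OF \<epsilon>] by blast
      then show ?thesis using LRB.cdf_nondecreasing[of x y] False by linarith
    qed
    have zero: "cdf (law P ?RB) x = 0"
      using field_le_epsilon[OF le] LRB.cdf_nonneg by (rule antisym)
    show ?thesis
      unfolding zero
    proof (rule order_tendstoI)
      fix \<epsilon> :: real
      assume "\<epsilon> < 0"
      then show "\<forall>\<^sub>F n in sequentially. \<epsilon> < cdf (law (M n) (?R n)) x"
        using LR.cdf_nonneg by (intro always_eventually allI) (rule less_le_trans)
    next
      fix \<epsilon> :: real
      assume "0 < \<epsilon>"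
      then obtain y where y: "0 < y" "cdf (law P ?RB) y < \<epsilon>" using small by blast
      \<comment> \<open>Monotonicity carries the bound from the positive level \<open>y\<close>,
        where convergence is known, down to \<open>x\<close>.\<close>
      from order_tendstoD(2)[OF cdf_pos[OF y(1)] y(2)]
      show "\<forall>\<^sub>F n in sequentially. cdf (law (M n) (?R n)) x < \<epsilon>"
      proof eventually_elim
        case (elim n)
        then show ?case using LR.cdf_nondecreasing[of x y n] False y(1) by linarith
      qed
    qed
  qed (rule cdf_pos)
  then show ?thesis
    by (simp add: weak_conv_m_def weak_conv_def T.cond_law_running_max[OF t])
qed

end
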